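(* Let $U\subset\mathbb{R}^2$ be open, let $f,g$ be smooth real-valued functions of one variable, and let $\varphi:U\to(V^3,F_b)$ be the immersion $\varphi(x^1,x^2)=(x^1,x^2,f(x^1)+g(x^2))$ into the Matsumoto space $(V^3,F_b)$. Then $\varphi$ is minimal if and only if $$\lambda f_{x^1x^1}+\mu g_{x^2x^2}=0,$$ where $$\lambda=(1+g_{x^2}^2)\big[2+(2+b^2)(f_{x^1}^2+g_{x^2}^2)\big]\big[2(1-b^2)+(2+b^2)(f_{x^1}^2+g_{x^2}^2)\big]+6b^2f_{x^1}^2\big\{2+(2-b^2)(f_{x^1}^2+g_{x^2}^2)\big\}$$ and $$\mu=(1+f_{x^1}^2)\big[2+(2+b^2)(f_{x^1}^2+g_{x^2}^2)\big]\big[2(1-b^2)+(2+b^2)(f_{x^1}^2+g_{x^2}^2)\big]+6b^2g_{x^2}^2\big\{2+(2-b^2)(f_{x^1}^2+g_{x^2}^2)\big\}.$$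
   Context: Subscripts on $f,g$ denote derivatives. Greek indices range over $\{1,2\}$, Latin indices over $\{1,2,3\}$, and repeated indices are summed. $V^3$ is a $3$-dimensional real vector space with linear coordinates $(\tilde x^1,\tilde x^2,\tilde x^3)$, and $F_b=\frac{\tilde\alpha^2}{\tilde\alpha-\tilde\beta}$ is the Minkowski Matsumoto metric on it, where $\tilde\alpha$ is the Euclidean metric, $\tilde\alpha(y)=\sqrt{(y^1)^2+(y^2)^2+(y^3)^2}$, and $\tilde\beta=b\,d\tilde x^3$, i.e. $\tilde\beta(y)=b\,y^3$, with $b$ a constant, $0\le b<1/2$ (and $F_b(0)=0$). For a $3\times 2$ matrix $z=(z^i_\epsilon)$ of rank $2$ put $$\mathcal F(z)=\frac{\mathrm{vol}(B^2)}{\mathrm{vol}(D_z)},\qquad D_z=\{(y^1,y^2)\in\mathbb{R}^2: F_b(y^\epsilon z_\epsilon)<1\},\quad z_\epsilon=(z^1_\epsilon,z^2_\epsilon,z^3_\epsilon),$$ with $B^2$ the Euclidean unit disc and $\mathrm{vol}$ Euclidean area. For an immersion $\varphi$ with $z^i_\epsilon=\partial\varphi^i/\partial x^\epsilon$, the mean curvature (with respect to the Busemann-Hausdorff volume) is $$\mathcal H_\varphi(v)=\frac{1}{\mathcal F}\Big\{\frac{\partial^2\mathcal F}{\partial z^i_\epsilon\partial z^j_\eta}\frac{\partial^2\varphi^j}{\partial x^\epsilon\partial x^\eta}\Big\}v^i$$ for vector fields $v=(v^i)$ along $\varphi$; $\varphi$ is called minimal when $\mathcal H_\varphi=0$, i.e.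 $\mathcal H_\varphi(v)=0$ for all $v$. *)

theory Defs
  imports "HOL-Analysis.Analysis"
begin

text \<open>Meaningful for open \<open>S\<close>: derivatives are two-sided, so values of \<open>h\<close> outside \<open>S\<close> are
  irrelevant.\<close>
definition smooth_on :: "(real \<Rightarrow> real) \<Rightarrow> real set \<Rightarrow> bool" where
  "smooth_on h S \<longleftrightarrow> (\<forall>n. \<forall>t\<in>S. (deriv ^^ n) h field_differentiable at t)"

text \<open>The coordinate partial derivative of \<open>F\<close> when \<open>e\<close> is a standard basis vector. The coordinate
  \<open>x\<^sup>\<epsilon>\<close> of \<open>real ^ 2\<close> belongs to \<open>axis \<epsilon> 1\<close>; the coordinate \<open>z\<^sup>i\<^sub>\<epsilon>\<close> of a \<open>3 \<times> 2\<close> matrix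
  (\<open>real ^ 2 ^ 3\<close>, entry \<open>z $ i $ \<epsilon>\<close>) belongs to \<open>axis i (axis \<epsilon> 1)\<close>.\<close>
definition partial_deriv :: "'a::real_normed_vector \<Rightarrow> ('a \<Rightarrow> real) \<Rightarrow> 'a \<Rightarrow> real" where
  "partial_deriv e F x = deriv (\<lambda>t. F (x + t *\<^sub>R e)) 0"

abbreviation mat_unit :: "3 \<Rightarrow> 2 \<Rightarrow> real ^ 2 ^ 3" where
  "mat_unit i \<epsilon> \<equiv> axis i (axis \<epsilon> 1)"

text \<open>At \<open>y = 0\<close> this is \<open>0 / 0 = 0\<close>, the required value.\<close>
definition matsumoto :: "real \<Rightarrow> real ^ 3 \<Rightarrow> real" where
  "matsumoto b y = (norm y)\<^sup>2 / (norm y - b * y $ 3)"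

text \<open>\<open>z *v y\<close> is the vector \<open>y\<^sup>\<epsilon> z\<^sub>\<epsilon>\<close>. The value of \<open>BH_density b z\<close> is meaningful only for \<open>z\<close> of
  rank 2; these form an open set of matrices, so the derivatives of \<open>BH_density b\<close> at such a \<open>z\<close> do
  not depend on the values elsewhere.\<close>
definition BH_density :: "real \<Rightarrow> real ^ 2 ^ 3 \<Rightarrow> real" where
  "BH_density b z =
     measure lborel (ball (0 :: real ^ 2) 1) / measure lborel {y :: real ^ 2. matsumoto b (z *v y) < 1}"

definition jacobian_matrix :: "(real ^ 2 \<Rightarrow> real ^ 3) \<Rightarrow> real ^ 2 \<Rightarrow> real ^ 2 ^ 3" where
  "jacobian_matrix \<phi> x = (\<chi> i \<epsilon>. partial_deriv (axis \<epsilon> 1) (\<lambda>u. \<phi> u $ i) x)"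

definition mean_curvature ::
    "real \<Rightarrow> (real ^ 2 \<Rightarrow> real ^ 3) \<Rightarrow> (real ^ 2 \<Rightarrow> real ^ 3) \<Rightarrow> real ^ 2 \<Rightarrow> real" where
  "mean_curvature b \<phi> v x =
     1 / BH_density b (jacobian_matrix \<phi> x) *
     (\<Sum>i\<in>UNIV.
        (\<Sum>j\<in>UNIV. \<Sum>\<epsilon>\<in>UNIV. \<Sum>\<eta>\<in>UNIV.
            partial_deriv (mat_unit i \<epsilon>) (partial_deriv (mat_unit j \<eta>) (BH_density b))
              (jacobian_matrix \<phi> x) *
            partial_deriv (axis \<epsilon> 1) (partial_deriv (axis \<eta> 1) (\<lambda>u. \<phi> u $ j)) x) *
        v x $ i)"

text \<open>Intended for immersions \<open>\<phi>\<close> of an open set \<open>U\<close>. A vector field along \<open>\<phi>\<close> is a map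
  \<open>v : U \<rightarrow> V\<^sup>3\<close>. No regularity of \<open>v\<close> is imposed: the mean curvature at \<open>x\<close> only involves \<open>v x\<close>, and
  constant fields already realise every value.\<close>
definition minimal_on :: "real \<Rightarrow> (real ^ 2) set \<Rightarrow> (real ^ 2 \<Rightarrow> real ^ 3) \<Rightarrow> bool" where
  "minimal_on b U \<phi> \<longleftrightarrow> (\<forall>v. \<forall>x\<in>U. mean_curvature b \<phi> v x = 0)"

definition translation_surface :: "(real \<Rightarrow> real) \<Rightarrow> (real \<Rightarrow> real) \<Rightarrow> real ^ 2 \<Rightarrow> real ^ 3" where
  "translation_surface f g x = vector [x $ 1, x $ 2, f (x $ 1) + g (x $ 2)]"

text \<open>The coefficients \<open>\<lambda>\<close> and \<open>\<mu>\<close>, as functions of \<open>p = f\<^sub>x\<^sub>1\<close> and \<open>q = g\<^sub>x\<^sub>2\<close>.\<close>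
definition coeff_lambda :: "real \<Rightarrow> real \<Rightarrow> real \<Rightarrow> real" where
  "coeff_lambda b p q =
     (1 + q\<^sup>2) * (2 + (2 + b\<^sup>2) * (p\<^sup>2 + q\<^sup>2)) * (2 * (1 - b\<^sup>2) + (2 + b\<^sup>2) * (p\<^sup>2 + q\<^sup>2))
     + 6 * b\<^sup>2 * p\<^sup>2 * (2 + (2 - b\<^sup>2) * (p\<^sup>2 + q\<^sup>2))"

definition coeff_mu :: "real \<Rightarrow> real \<Rightarrow> real \<Rightarrow> real" where
  "coeff_mu b p q =
     (1 + p\<^sup>2) * (2 + (2 + b\<^sup>2) * (p\<^sup>2 + q\<^sup>2)) * (2 * (1 - b\<^sup>2) + (2 + b\<^sup>2) * (p\<^sup>2 + q\<^sup>2))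
     + 6 * b\<^sup>2 * q\<^sup>2 * (2 + (2 - b\<^sup>2) * (p\<^sup>2 + q\<^sup>2))"

text \<open>Translation surfaces are automatically immersions.\<close>

lemma jacobian_translation_surface:
  assumes "f field_differentiable at (x $ 1)" and "g field_differentiable at (x $ 2)"
  shows "jacobian_matrix (translation_surface f g) x =
    vector [vector [1, 0], vector [0, 1], vector [deriv f (x $ 1), deriv g (x $ 2)]]"
proof -
  have f: "(f has_field_derivative deriv f (x $ 1)) (at (x $ 1))"
    and g: "(g has_field_derivative deriv g (x $ 2)) (at (x $ 2))"
    using assms by (simp_all add: field_differentiable_derivI)
  have "((\<lambda>t. f (x $ 1 + t)) has_field_derivative deriv f (x $ 1)) (at 0)"
    using DERIV_at_within_shift[of f "deriv f (x $ 1)" "x $ 1" 0 UNIV] f by simp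
  then have F: "((\<lambda>t. f (x $ 1 + t) + c) has_field_derivative deriv f (x $ 1)) (at 0)" for c
    by (auto intro!: derivative_eq_intros)
  have "((\<lambda>t. g (x $ 2 + t)) has_field_derivative deriv g (x $ 2)) (at 0)"
    using DERIV_at_within_shift[of g "deriv g (x $ 2)" "x $ 2" 0 UNIV] g by simp
  then have G: "((\<lambda>t. c + g (x $ 2 + t)) has_field_derivative deriv g (x $ 2)) (at 0)" for c
    by (auto intro!: derivative_eq_intros)
  have I: "deriv ((+) c) 0 = 1" for c :: real
    by (rule DERIV_imp_deriv) (auto intro!: derivative_eq_intros)
  show ?thesis
    by (simp add: vec_eq_iff forall_3 forall_2 jacobian_matrix_def partial_deriv_def
        translation_surface_def axis_def DERIV_imp_deriv[OF F] DERIV_imp_deriv[OF G] I)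
qed

lemma translation_surface_immersion:
  assumes "f field_differentiable at (x $ 1)" and "g field_differentiable at (x $ 2)"
  shows "rank (jacobian_matrix (translation_surface f g) x) = 2"
proof -
  let ?J = "jacobian_matrix (translation_surface f g) x"
  have "inj ((*v) ?J)"
    unfolding inj_on_def jacobian_translation_surface[OF assms]
    by (simp add: vec_eq_iff forall_3 forall_2 matrix_vector_mult_def sum_2)
  then show ?thesis
    using full_rank_injective[of ?J] by simp
qed

end

theory Submission
  imports Defs
begin

unbundle cross3_syntax

text \<open>
  For a matrix \<open>z\<close> of rank 2 let \<open>n\<close> be the cross product of its columns. In a Euclidean orthonormal
  frame of the plane spanned by the columns, \<open>F\<^sub>b < 1\<close> becomes the interior
  \<open>r < 1 - c cos \<theta>\<close> of a limacon, of area \<open>\<pi> (1 + c\<^sup>2 / 2)\<close> with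
  \<open>c\<^sup>2 = b\<^sup>2 (1 - n\<^sub>3\<^sup>2 / |n|\<^sup>2)\<close> (\<open>measure_limacon\<close>). Passing to the frame costs the factor
  \<open>1 / |n|\<close>, so the Busemann-Hausdorff density is the explicit function
  \<open>2 |n|\<^sup>3 / ((2 + b\<^sup>2) |n|\<^sup>2 - b\<^sup>2 n\<^sub>3\<^sup>2)\<close> of \<open>z\<close> (\<open>BH_density_eq\<close>).

  A translation surface has \<open>\<phi>\<^sup>3\<close> as its only component with nonzero second derivatives, and
  these are \<open>f''\<close> and \<open>g''\<close> on the diagonal. So only six entries of the Hessian of the density
  matter; each is a common positive factor times a component of \<open>n\<close> times the Euler-Lagrange
  coefficient \<open>\<Lambda>(p, q)\<close> or \<open>\<Lambda>(q, p)\<close>, where \<open>p = f'\<close>, \<open>q = g'\<close>. Hence the surface is minimal iff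
  \<open>\<Lambda>(p, q) f'' + \<Lambda>(q, p) g'' = 0\<close> on \<open>U\<close> (\<open>minimal_translation_surface_iff\<close>). Here
  \<open>\<Lambda>\<close> is \<open>euler_coeff b\<close>.

  For \<open>b = 0\<close> the coefficients \<open>\<lambda>, \<mu>\<close> of the theorem are \<open>\<Lambda>(p, q), \<Lambda>(q, p)\<close>. For \<open>b \<noteq> 0\<close> they are
  not even proportional to them: \<open>\<Lambda>\<close> has \<open>2 b\<^sup>2 p\<^sup>2 (2 + 4 b\<^sup>2 + (2 + b\<^sup>2) (p\<^sup>2 + q\<^sup>2))\<close>
  where \<open>\<lambda>\<close> has \<open>6 b\<^sup>2 p\<^sup>2 (2 + (2 - b\<^sup>2) (p\<^sup>2 + q\<^sup>2))\<close>. Nevertheless both equations have the same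
  solutions, because each forces \<open>f'' = g'' = 0\<close>. Indeed, near a point
  where \<open>f''\<close> and \<open>g''\<close> do not vanish, the equation makes \<open>\<lambda>(p, q) / \<lambda>(q, p)\<close> a product of a
  function of \<open>p\<close> and a function of \<open>q\<close> on an infinite grid. This is a polynomial identity, so it would hold
  everywhere (\<open>separated_equation_iff\<close>), and evaluating it at one quadruple of
  slopes refutes it, for \<open>\<lambda>\<close> and for \<open>\<Lambda>\<close> (\<open>coeffs_not_separable\<close>).
\<close>

section \<open>The area inside a limacon\<close>

lemma det_scaled_identity_plus_rank_one:
  fixes k u :: "real ^ 2"
  shows "det (matrix (\<lambda>h. a *\<^sub>R h + (k \<bullet> h) *\<^sub>R u)) = a * (a + k \<bullet> u)"
  by (simp add: det_2 matrix_def inner_vec_def sum_2 axis_def algebra_simps)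

text \<open>This map pushes the disc radially onto the inside of the limacon. Its scaling factor is
  homogeneous of degree 0, so the gradient of the factor is orthogonal to \<open>u\<close> and the Jacobian is
  just the square of the factor.\<close>
lemma limacon_map_has_derivative:
  fixes c u :: "real ^ 2"
  assumes "u \<noteq> 0"
  shows "((\<lambda>u. (1 - c \<bullet> u / norm u) *\<^sub>R u) has_derivative
    (\<lambda>h. (1 - c \<bullet> u / norm u) *\<^sub>R h +
      (((c \<bullet> u / norm u ^ 3) *\<^sub>R u - (1 / norm u) *\<^sub>R c) \<bullet> h) *\<^sub>R u)) (at u within S)"
proof -
  have n: "(norm has_derivative (\<lambda>h. u \<bullet> h / norm u)) (at u within S)"
    using has_derivative_at_withinI[OF has_derivative_norm[OF assms]]
    by (simp add: sgn_div_norm divide_inverse_commute inner_commute)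
  have d: "((\<lambda>u. c \<bullet> u / norm u) has_derivative
      (\<lambda>h. - (c \<bullet> u) * (inverse (norm u) * (u \<bullet> h / norm u) * inverse (norm u)) + (c \<bullet> h) / norm u)) (at u within S)"
    using assms by (intro has_derivative_divide has_derivative_inner_right has_derivative_ident n) auto
  have "- (c \<bullet> u) * (inverse (norm u) * (u \<bullet> h / norm u) * inverse (norm u)) + (c \<bullet> h) / norm u
      = - (((c \<bullet> u / norm u ^ 3) *\<^sub>R u - (1 / norm u) *\<^sub>R c) \<bullet> h)" for h
    using assms unfolding inner_diff_left inner_scaleR_left by (simp add: divide_simps power3_eq_cube)
  then have eq: "(\<lambda>h. - (c \<bullet> u) * (inverse (norm u) * (u \<bullet> h / norm u) * inverse (norm u)) + (c \<bullet> h) / norm u)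
      = (\<lambda>h. - (((c \<bullet> u / norm u ^ 3) *\<^sub>R u - (1 / norm u) *\<^sub>R c) \<bullet> h))"
    by (rule ext)
  with d have "((\<lambda>u. c \<bullet> u / norm u) has_derivative
      (\<lambda>h. - (((c \<bullet> u / norm u ^ 3) *\<^sub>R u - (1 / norm u) *\<^sub>R c) \<bullet> h))) (at u within S)"
    unfolding eq by simp
  from has_derivative_scaleR[OF has_derivative_diff[OF has_derivative_const[of 1] this] has_derivative_ident]
  show ?thesis
    by simp
qed

definition quarter_turn :: "real ^ 2 \<Rightarrow> real ^ 2" where
  "quarter_turn u = vector [- u $ 2, u $ 1]"

lemma linear_quarter_turn: "linear quarter_turn"
  by (rule linearI) (simp_all add: quarter_turn_def vec_eq_iff forall_2)

lemma det_quarter_turn: "det (matrix quarter_turn) = 1"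
  by (simp add: det_2 matrix_def quarter_turn_def axis_def)

lemma norm_quarter_turn [simp]: "norm (quarter_turn u) = norm u"
  by (simp add: norm_vec_def L2_set_def sum_2 quarter_turn_def add.commute)

lemma quarter_turn_quarter_turn: "quarter_turn (quarter_turn u) = - u"
  by (simp add: quarter_turn_def vec_eq_iff forall_2)

lemma inner_quarter_turn_sq: "(c \<bullet> u)\<^sup>2 + (c \<bullet> quarter_turn u)\<^sup>2 = (norm c)\<^sup>2 * (norm u)\<^sup>2"
  unfolding power2_norm_eq_inner
  by (simp add: inner_vec_def sum_2 quarter_turn_def power2_eq_square algebra_simps)

lemma inner_quarter_turn: "c \<bullet> quarter_turn u = - (quarter_turn c \<bullet> u)"
  by (simp add: inner_vec_def sum_2 quarter_turn_def)

text \<open>For \<open>|c| < 1\<close>, in polar coordinates around the direction of \<open>c\<close>, this is \<open>r < 1 - |c| cos \<theta>\<close>. The quotient form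
  matches the metric; at \<open>u = 0\<close> it reads \<open>0 / 0 = 0\<close>, so the origin belongs to the set.\<close>
definition limacon :: "real ^ 2 \<Rightarrow> (real ^ 2) set" where
  "limacon c = {u. (norm u)\<^sup>2 / (norm u - c \<bullet> u) < 1}"

text \<open>The inside of the limacon is, up to the origin, the injective image of the punctured disc
  under the map of \<open>limacon_map_has_derivative\<close>.\<close>
lemma measure_limacon_eq_integral:
  fixes c :: "real ^ 2"
  assumes "norm c < 1"
  defines "S \<equiv> ball 0 1 - {0}"
  shows "limacon c \<in> lmeasurable"
    and "((\<lambda>u. (1 - c \<bullet> u / norm u)\<^sup>2) has_integral measure lebesgue (limacon c)) S"
proof -
  define P where "P = (\<lambda>u. (1 - c \<bullet> u / norm u)\<^sup>2)"
  define g where "g = (\<lambda>u. (1 - c \<bullet> u / norm u) *\<^sub>R u)"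
  define g' where "g' = (\<lambda>u h. (1 - c \<bullet> u / norm u) *\<^sub>R h +
      (((c \<bullet> u / norm u ^ 3) *\<^sub>R u - (1 / norm u) *\<^sub>R c) \<bullet> h) *\<^sub>R u)"
  have S: "S \<in> lmeasurable"
    unfolding S_def by (intro fmeasurable_Diff) auto
  have less: "\<bar>c \<bullet> u / norm u\<bar> < 1" if "u \<noteq> 0" for u
  proof -
    have "\<bar>c \<bullet> u\<bar> \<le> norm c * norm u"
      by (rule Cauchy_Schwarz_ineq2)
    also have "\<dots> < norm u"
      using that \<open>norm c < 1\<close> by simp
    finally show ?thesis
      using that by (simp add: divide_simps)
  qed
  have P: "P absolutely_integrable_on S"
  proof (rule measurable_bounded_by_integrable_imp_absolutely_integrable)
    show "P \<in> borel_measurable (lebesgue_on S)"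
      using S unfolding P_def
      by (intro continuous_imp_measurable_on_sets_lebesgue continuous_intros) (auto simp: S_def)
    show "S \<in> sets lebesgue" using S by blast
    show "(\<lambda>x. 4) integrable_on S" 
      using S integrable_on_const by blast
    show "norm (P u) \<le> 4" if "u \<in> S" for u
    proof -
      have "\<bar>1 - c \<bullet> u / norm u\<bar> \<le> \<bar>2\<bar>"
        using less[of u] that unfolding S_def by (smt (verit) DiffD2 singletonI)
      then show ?thesis
        unfolding P_def using abs_le_square_iff[of "1 - c \<bullet> u / norm u" 2] by simp
    qed
  qed
  have det: "\<bar>det (matrix (g' u))\<bar> = P u" if "u \<in> S" for u
  proof -
    have "((c \<bullet> u / norm u ^ 3) *\<^sub>R u - (1 / norm u) *\<^sub>R c) \<bullet> u = 0"
      using that by (simp add: S_def inner_simps power3_eq_cube power2_norm_eq_inner[symmetric] power2_eq_square)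
    then show ?thesis
      unfolding g'_def P_def det_scaled_identity_plus_rank_one by (simp add: power2_eq_square)
  qed
  \<comment> \<open>\<open>g\<close> keeps directions, and its scaling factor depends on the direction only.\<close>
  have dir: "sgn (g u) = sgn u" "norm (g u) = (1 - c \<bullet> u / norm u) * norm u" if "u \<in> S" for u
    using less[of u] that by (auto simp: g_def S_def sgn_scaleR)
  have inj: "inj_on g S"
  proof (rule inj_onI)
    fix u v assume uv: "u \<in> S" "v \<in> S" "g u = g v"
    then have s: "sgn u = sgn v"
      using dir(1) by metis
    have *: "c \<bullet> w / norm w = c \<bullet> sgn w" for w :: "real ^ 2"
      by (simp add: sgn_div_norm divide_inverse_commute)
    have "(1 - c \<bullet> sgn u) * norm u = (1 - c \<bullet> sgn u) * norm v"
      using dir(2)[OF uv(1), unfolded *] dir(2)[OF uv(2), unfolded *] uv(3) s by metis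
    moreover have "1 - c \<bullet> sgn u \<noteq> 0"
      using less[of u] uv by (simp add: * S_def)
    ultimately have "norm u = norm v" by simp
    then show "u = v"
      using s uv by (auto simp: sgn_div_norm S_def)
  qed
  have image: "g ` S = limacon c - {0}"
  proof (intro set_eqI iffI)
    fix v assume "v \<in> g ` S"
    then obtain u where u: "u \<in> S" "v = g u" by auto
    then have "norm u < 1" "u \<noteq> 0"
      by (auto simp: S_def)
    define t where "t = 1 - c \<bullet> u / norm u"
    have t: "0 < t" "v = t *\<^sub>R u" "norm u - c \<bullet> u = t * norm u"
      using less[OF \<open>u \<noteq> 0\<close>] \<open>u \<noteq> 0\<close> by (auto simp: t_def u(2) g_def algebra_simps)
    have "(norm v)\<^sup>2 / (norm v - c \<bullet> v) = (t * norm u)\<^sup>2 / (t * (norm u - c \<bullet> u))"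
      using t(1) by (simp add: t(2) algebra_simps)
    also have "\<dots> = norm u"
      using t(1) \<open>u \<noteq> 0\<close> by (simp add: t(3) power2_eq_square)
    finally show "v \<in> limacon c - {0}"
      using \<open>norm u < 1\<close> \<open>u \<noteq> 0\<close> t by (simp add: limacon_def)
  next
    fix v assume v: "v \<in> limacon c - {0}"
    \<comment> \<open>The inverse of \<open>g\<close> divides by the scaling factor of the common direction.\<close>
    define u where "u = inverse (1 - c \<bullet> v / norm v) *\<^sub>R v"
    define t where "t = 1 - c \<bullet> v / norm v"
    have "v \<noteq> 0" and v1: "(norm v)\<^sup>2 / (norm v - c \<bullet> v) < 1"
      using v by (auto simp: limacon_def)
    have t: "0 < t" "u = inverse t *\<^sub>R v" "norm v - c \<bullet> v = t * norm v"
      using less[OF \<open>v \<noteq> 0\<close>] \<open>v \<noteq> 0\<close> by (auto simp: t_def u_def algebra_simps)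
    have "norm v < t"
      using v1 t(1) \<open>v \<noteq> 0\<close> by (simp add: t(3) power2_eq_square)
    then have "u \<in> S"
      using t(1) \<open>v \<noteq> 0\<close> by (simp add: S_def t(2) divide_simps)
    moreover have "1 - c \<bullet> u / norm u = t"
      using t(1) \<open>v \<noteq> 0\<close> by (simp add: t(2) t_def)
    then have "g u = v"
      using t(1) by (simp add: g_def) (simp add: t(2))
    ultimately show "v \<in> g ` S" by blast
  qed
  have "(P has_integral integral S P) S"
    using P absolutely_integrable_on_def by blast
  then have "((\<lambda>u. \<bar>det (matrix (g' u))\<bar>) has_integral integral S P) S"
    using det by (simp cong: has_integral_cong)
  moreover have "(g has_derivative g' u) (at u within S)" if "u \<in> S" for u
    using that unfolding g_def g'_def S_def by (intro limacon_map_has_derivative) auto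
  ultimately have m: "limacon c - {0} \<in> lmeasurable" "measure lebesgue (limacon c - {0}) = integral S P"
    using has_measure_differentiable_image[of S g g' "integral S P"] S inj image by auto
  \<comment> \<open>The map \<open>g\<close> is singular at the origin, a single point of measure zero.\<close>
  have z: "limacon c = insert 0 (limacon c - {0})"
    by (auto simp: limacon_def)
  show L: "limacon c \<in> lmeasurable"
    by (subst z, subst insert_is_Un) (intro fmeasurable.Un m(1) lmeasurable_compact, simp)
  have "measure lebesgue (limacon c) = integral S P"
    using m(2) measure_negligible_symdiff[of "limacon c - {0}" "limacon c"]
    using m(1) by (auto intro: negligible_subset[of "{0}"])
  then show "((\<lambda>u. (1 - c \<bullet> u / norm u)\<^sup>2) has_integral measure lebesgue (limacon c)) S"
    using \<open>(P has_integral integral S P) S\<close> by (simp add: P_def)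
qed

lemma quarter_turn_image_limacon: "quarter_turn ` limacon c = limacon (quarter_turn c)"
proof (intro set_eqI iffI)
  fix v assume "v \<in> quarter_turn ` limacon c"
  then show "v \<in> limacon (quarter_turn c)"
    by (auto simp: limacon_def inner_quarter_turn quarter_turn_quarter_turn)
next
  fix v assume v: "v \<in> limacon (quarter_turn c)"
  have "v = quarter_turn (- quarter_turn v)"
    using quarter_turn_quarter_turn[of "- v"] by (simp add: quarter_turn_def vec_eq_iff forall_2)
  moreover have "- quarter_turn v \<in> limacon c"
    using v by (simp add: limacon_def inner_quarter_turn norm_quarter_turn)
  ultimately show "v \<in> quarter_turn ` limacon c" by blast
qed

text \<open>A quarter turn of \<open>c\<close> rotates the limacon and keeps its area. In the sum of the four integrands
  of \<open>measure_limacon_eq_integral\<close> for \<open>c\<close>, \<open>- c\<close> and the quarter turns \<open>d\<close>, \<open>- d\<close> of \<open>c\<close>, the linear terms cancel and the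
  squares add up by Pythagoras, so that the sum is the constant \<open>4 + 2 |c|\<^sup>2\<close>.\<close>
lemma measure_limacon:
  fixes c :: "real ^ 2"
  assumes "norm c < 1"
  shows "measure lebesgue (limacon c) = measure lebesgue (ball 0 1 :: (real ^ 2) set) * (1 + (norm c)\<^sup>2 / 2)"
proof -
  let ?S = "ball 0 1 - {0} :: (real ^ 2) set"
  define V where "V = (\<lambda>c. measure lebesgue (limacon c))"
  have V: "((\<lambda>u. (1 - e \<bullet> u / norm u)\<^sup>2) has_integral V e) ?S" if "norm e < 1" for e
    using measure_limacon_eq_integral[OF that] by (simp add: V_def)
  have turn: "V (quarter_turn e) = V e" if "norm e < 1" for e
    using measure_linear_image[OF linear_quarter_turn measure_limacon_eq_integral(1)[OF that]]
    by (simp add: V_def quarter_turn_image_limacon det_quarter_turn)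
  have V': "V (- e) = V e" if "norm e < 1" for e
    using turn[OF that] turn[of "quarter_turn e"] that by (simp add: quarter_turn_quarter_turn)
  let ?d = "quarter_turn c"
  have sum: "((\<lambda>u. ((1 - c \<bullet> u / norm u)\<^sup>2 + (1 - (- c) \<bullet> u / norm u)\<^sup>2)
          + ((1 - ?d \<bullet> u / norm u)\<^sup>2 + (1 - (- ?d) \<bullet> u / norm u)\<^sup>2))
        has_integral (V c + V (- c)) + (V ?d + V (- ?d))) ?S"
    using assms by (intro has_integral_add V) auto
  have eq: "((1 - c \<bullet> u / norm u)\<^sup>2 + (1 - (- c) \<bullet> u / norm u)\<^sup>2)
          + ((1 - ?d \<bullet> u / norm u)\<^sup>2 + (1 - (- ?d) \<bullet> u / norm u)\<^sup>2) = 4 + 2 * (norm c)\<^sup>2"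
    if "u \<in> ?S" for u
  proof -
    have "(c \<bullet> u)\<^sup>2 + (?d \<bullet> u)\<^sup>2 = (norm c)\<^sup>2 * (norm u)\<^sup>2"
      using inner_quarter_turn_sq[of c u] by (simp add: inner_quarter_turn)
    then have "(c \<bullet> u / norm u)\<^sup>2 + (?d \<bullet> u / norm u)\<^sup>2 = (norm c)\<^sup>2"
      using that by (simp add: power_divide add_divide_distrib[symmetric])
    moreover have "((1 - x)\<^sup>2 + (1 - (- x))\<^sup>2) + ((1 - y)\<^sup>2 + (1 - (- y))\<^sup>2) = 4 + 2 * (x\<^sup>2 + y\<^sup>2)" for x y :: real
      by (simp add: power2_eq_square algebra_simps)
    ultimately show ?thesis
      unfolding inner_minus_left minus_divide_left[symmetric] by simp
  qed
  from sum have sum4: "((\<lambda>u. 4 + 2 * (norm c)\<^sup>2) has_integral (V c + V (- c)) + (V ?d + V (- ?d))) ?S"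
    by (rule has_integral_eq[rotated]) (rule eq)
  have four: "(V c + V (- c)) + (V ?d + V (- ?d)) = 4 * V c"
    using V'[OF assms] V'[of ?d] turn[OF assms] assms by simp
  have "((\<lambda>u. 4 + 2 * (norm c)\<^sup>2) has_integral 4 * V c) ?S"
    using sum4 unfolding four .
  moreover have "((\<lambda>u. (4 + 2 * (norm c)\<^sup>2)) has_integral (4 + 2 * (norm c)\<^sup>2) * measure lebesgue (ball 0 1 :: (real ^ 2) set)) ?S"
  proof -
    have ball: "((\<lambda>u :: real ^ 2. 1) has_integral measure lebesgue (ball 0 1 :: (real ^ 2) set)) (ball 0 1)"
      using has_integral_measure_lborel[OF _ emeasure_lborel_ball_finite, of "0 :: real ^ 2" 1] by simp
    have "((\<lambda>u :: real ^ 2. 4 + 2 * (norm c)\<^sup>2) has_integral (4 + 2 * (norm c)\<^sup>2) * measure lebesgue (ball 0 1 :: (real ^ 2) set)) (ball 0 1)"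
      using has_integral_mult_right[OF ball, of "4 + 2 * (norm c)\<^sup>2"] by simp
    then show ?thesis
      by (subst has_integral_spike_set_eq[of _ "ball 0 1"]) (auto intro: negligible_subset[of "{0}"])
  qed
  ultimately have "4 * V c = (4 + 2 * (norm c)\<^sup>2) * measure lebesgue (ball 0 1 :: (real ^ 2) set)"
    by (rule has_integral_unique)
  then show ?thesis
    by (simp add: V_def field_simps)
qed

section \<open>The Busemann-Hausdorff density\<close>

definition normal :: "real ^ 2 ^ 3 \<Rightarrow> real ^ 3" where
  "normal z = column 1 z \<times> column 2 z"

lemma normal_nth:
  "normal z $ 1 = z $ 2 $ 1 * z $ 3 $ 2 - z $ 3 $ 1 * z $ 2 $ 2"
  "normal z $ 2 = z $ 3 $ 1 * z $ 1 $ 2 - z $ 1 $ 1 * z $ 3 $ 2"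
  "normal z $ 3 = z $ 1 $ 1 * z $ 2 $ 2 - z $ 2 $ 1 * z $ 1 $ 2"
  by (simp_all add: normal_def cross3_def column_def)

text \<open>\<open>T\<close> is the Gram-Schmidt change of basis for the columns \<open>x, y\<close> of \<open>z\<close>. It turns the Euclidean
  norm of the surface plane into the standard one and the third coordinate into a linear form,
  whose norm is the cosine of the angle between the plane and the third axis.\<close>
lemma orthonormal_frame:
  fixes z :: "real ^ 2 ^ 3"
  assumes "normal z \<noteq> 0"
  obtains T :: "real ^ 2 \<Rightarrow> real ^ 2" and e :: "real ^ 2"
  where "linear T" and "det (matrix T) = 1 / norm (normal z)"
    and "\<And>u. norm (z *v T u) = norm u" and "\<And>u. (z *v T u) $ 3 = e \<bullet> u"
    and "(norm e)\<^sup>2 = 1 - (normal z $ 3)\<^sup>2 / (norm (normal z))\<^sup>2"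
proof -
  define x y where "x = column 1 z" and "y = column 2 z"
  define A D r where "A = x \<bullet> x" and "D = x \<bullet> y" and "r = norm (normal z)"
  have r: "r > 0" using assms by (simp add: r_def)
  have lagrange: "A * (y \<bullet> y) = r\<^sup>2 + D\<^sup>2"
    using norm_cross_dot[of x y]
    by (simp add: A_def D_def r_def normal_def x_def[symmetric] y_def[symmetric] power_mult_distrib power2_norm_eq_inner)
  then have "x \<noteq> 0" using r by (auto simp: A_def D_def)
  then have "A > 0" by (simp add: A_def)
  define s where "s = sqrt A"
  have s: "s > 0" "s\<^sup>2 = A" using \<open>A > 0\<close> by (simp_all add: s_def)
  \<comment> \<open>The component of \<open>y\<close> orthogonal to \<open>x\<close>, scaled by \<open>A\<close> to avoid a denominator.\<close>
  define w where "w = A *\<^sub>R y - D *\<^sub>R x"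
  have xw: "x \<bullet> x = s\<^sup>2" "x \<bullet> w = 0" "w \<bullet> w = (s * r)\<^sup>2"
  proof -
    show "x \<bullet> x = s\<^sup>2" by (simp add: s(2) A_def)
    show *: "x \<bullet> w = 0" by (simp add: w_def inner_diff_right A_def[symmetric] D_def[symmetric])
    have "w \<bullet> w = A * (y \<bullet> w)"
      using * by (subst (1) w_def) (simp add: inner_diff_left)
    also have "\<dots> = A * (A * (y \<bullet> y) - D * D)"
      by (simp add: w_def inner_diff_right D_def inner_commute)
    also have "\<dots> = (s * r)\<^sup>2"
      unfolding lagrange s(2) power_mult_distrib by (simp add: power2_eq_square)
    finally show "w \<bullet> w = (s * r)\<^sup>2" .
  qed
  define T :: "real ^ 2 \<Rightarrow> real ^ 2" where "T u = vector [u $ 1 / s - D * u $ 2 / (s * r), s * u $ 2 / r]" for u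
  define e :: "real ^ 2" where "e = vector [x $ 3 / s, w $ 3 / (s * r)]"
  show thesis
  proof
    show "linear T"
      by (rule linearI) (simp_all add: T_def vec_eq_iff forall_2 algebra_simps add_divide_distrib diff_divide_distrib)
    show "det (matrix T) = 1 / norm (normal z)"
      using s r by (simp add: det_2 matrix_def T_def axis_def r_def)
    have zT: "z *v T u = (u $ 1 / s) *\<^sub>R x + (u $ 2 / (s * r)) *\<^sub>R w" for u
    proof -
      have "s * u $ 2 / r = A * u $ 2 / (s * r)"
        using s(1) r by (simp add: s(2)[symmetric] power2_eq_square)
      then show ?thesis
        by (simp add: vec_eq_iff matrix_vector_mult_def sum_2 T_def w_def x_def y_def column_def algebra_simps diff_divide_distrib)
    qed
    show "(z *v T u) $ 3 = e \<bullet> u" for u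
      by (simp add: zT e_def inner_vec_def sum_2 mult.commute)
    have "(norm (z *v T u))\<^sup>2 = (norm u)\<^sup>2" for u
      using s(1) r unfolding zT power2_norm_eq_inner
      by (simp add: inner_add_left inner_add_right xw inner_commute[of w x] inner_vec_def[of u u] sum_2 power2_eq_square)
    then show "norm (z *v T u) = norm u" for u
      by (simp add: power2_eq_iff_nonneg)
    have "(norm e)\<^sup>2 = (r\<^sup>2 * (x $ 3)\<^sup>2 + (w $ 3)\<^sup>2) / (A * r\<^sup>2)"
      using s(1) r unfolding s(2)[symmetric]
      unfolding e_def power2_norm_eq_inner inner_vec_def sum_2 by (simp add: field_simps power2_eq_square)
    also have "r\<^sup>2 * (x $ 3)\<^sup>2 + (w $ 3)\<^sup>2 = A * (r\<^sup>2 - (normal z $ 3)\<^sup>2)"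
    proof -
      have "r\<^sup>2 - (normal z $ 3)\<^sup>2 = (normal z $ 1)\<^sup>2 + (normal z $ 2)\<^sup>2"
        unfolding r_def power2_norm_eq_inner inner_vec_def[of "normal z"] sum_3 by (simp add: power2_eq_square)
      also have "\<dots> = (y \<bullet> y) * (x $ 3)\<^sup>2 + (x \<bullet> x) * (y $ 3)\<^sup>2 - 2 * (x \<bullet> y) * x $ 3 * y $ 3"
        unfolding normal_def x_def[symmetric] y_def[symmetric]
        by (simp add: cross3_def inner_vec_def sum_3 power2_eq_square algebra_simps)
      finally have "r\<^sup>2 - (normal z $ 3)\<^sup>2 = (y \<bullet> y) * (x $ 3)\<^sup>2 + A * (y $ 3)\<^sup>2 - 2 * D * x $ 3 * y $ 3"
        unfolding A_def[symmetric] D_def[symmetric] .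
      then have "A * (r\<^sup>2 - (normal z $ 3)\<^sup>2)
          = A * ((y \<bullet> y) * (x $ 3)\<^sup>2 + A * (y $ 3)\<^sup>2 - 2 * D * x $ 3 * y $ 3)"
        by (rule arg_cong)
      also have "\<dots> = (A * (y \<bullet> y)) * (x $ 3)\<^sup>2 + A * (A * (y $ 3)\<^sup>2 - 2 * D * x $ 3 * y $ 3)"
        by (simp add: algebra_simps)
      finally have "A * (r\<^sup>2 - (normal z $ 3)\<^sup>2)
          = (A * (y \<bullet> y)) * (x $ 3)\<^sup>2 + A * (A * (y $ 3)\<^sup>2 - 2 * D * x $ 3 * y $ 3)" .
      then show ?thesis
        unfolding lagrange w_def by (simp add: power2_eq_square algebra_simps)
    qed
    finally show "(norm e)\<^sup>2 = 1 - (normal z $ 3)\<^sup>2 / (norm (normal z))\<^sup>2"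
      using \<open>A > 0\<close> r unfolding r_def[symmetric] by (simp add: diff_divide_distrib)
  qed
qed

text \<open>In the frame of \<open>orthonormal_frame\<close> the domain \<open>D\<^sub>z\<close> is the image under \<open>T\<close> of the limacon with
  parameter \<open>b e\<close>.\<close>
lemma BH_density_eq:
  assumes "\<bar>b\<bar> < 1" and "normal z \<noteq> 0"
  shows "BH_density b z =
    2 * norm (normal z) ^ 3 / ((2 + b\<^sup>2) * (norm (normal z))\<^sup>2 - b\<^sup>2 * (normal z $ 3)\<^sup>2)"
proof -
  obtain T :: "real ^ 2 \<Rightarrow> real ^ 2" and e where T: "linear T" "det (matrix T) = 1 / norm (normal z)"
    "\<And>u. norm (z *v T u) = norm u" "\<And>u. (z *v T u) $ 3 = e \<bullet> u"
    and e: "(norm e)\<^sup>2 = 1 - (normal z $ 3)\<^sup>2 / (norm (normal z))\<^sup>2"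
    using orthonormal_frame[OF assms(2)] by metis
  define r where "r = norm (normal z)"
  have r: "r > 0" using assms(2) by (simp add: r_def)
  let ?D = "{y. matsumoto b (z *v y) < 1}"
  have "(norm e)\<^sup>2 \<le> 1" unfolding e by simp
  then have "norm e \<le> 1" by (simp add: power_le_one_iff abs_square_le_1)
  then have c: "norm (b *\<^sub>R e) < 1"
    using assms(1) mult_left_le[of "norm e" "\<bar>b\<bar>"] by simp
  have "surj T"
    using T(1,2) r by (intro linear_injective_imp_surjective) (simp_all add: det_nz_iff_inj[symmetric] r_def)
  have D: "?D = T ` limacon (b *\<^sub>R e)"
  proof (intro set_eqI iffI)
    fix y assume y: "y \<in> ?D"
    obtain u where "y = T u" using \<open>surj T\<close> by blast
    then show "y \<in> T ` limacon (b *\<^sub>R e)"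
      using y by (auto simp: limacon_def matsumoto_def T)
  qed (auto simp: limacon_def matsumoto_def T)
  have "continuous_on UNIV (\<lambda>y. z *v y)"
    by (simp add: matrix_vector_mul_linear linear_continuous_on linear_linear)
  then have [measurable]: "(\<lambda>y. z *v y) \<in> borel_measurable borel"
    by (rule borel_measurable_continuous_onI)
  have [measurable]: "(\<lambda>w :: real ^ 3. w $ 3) \<in> borel_measurable borel"
    by (intro borel_measurable_continuous_onI continuous_intros)
  have "?D \<in> sets lborel"
    unfolding matsumoto_def by measurable
  then have "measure lborel ?D = measure lebesgue ?D"
    by simp
  also have "\<dots> = 1 / r * (measure lebesgue (ball 0 1 :: (real ^ 2) set) * (1 + b\<^sup>2 * (norm e)\<^sup>2 / 2))"
    using measure_linear_image[OF T(1) measure_limacon_eq_integral(1)[OF c]] measure_limacon[OF c] r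
    by (simp add: D T(2) r_def power_mult_distrib)
  finally have "BH_density b z = r / (1 + b\<^sup>2 * (1 - (normal z $ 3)\<^sup>2 / r\<^sup>2) / 2)"
    unfolding BH_density_def e r_def[symmetric] by simp
  also have "\<dots> = 2 * r ^ 3 / ((2 + b\<^sup>2) * r\<^sup>2 - b\<^sup>2 * (normal z $ 3)\<^sup>2)"
  proof -
    have "1 + b\<^sup>2 * (1 - (normal z $ 3)\<^sup>2 / r\<^sup>2) / 2 = ((2 + b\<^sup>2) * r\<^sup>2 - b\<^sup>2 * (normal z $ 3)\<^sup>2) / (2 * r\<^sup>2)"
      using r by (simp add: field_simps)
    then show ?thesis
      by (simp add: power3_eq_cube power2_eq_square)
  qed
  finally show ?thesis
    by (simp add: r_def)
qed

section \<open>Second derivatives of the density\<close>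

definition sq_normal :: "real ^ 2 ^ 3 \<Rightarrow> real" where
  "sq_normal z = normal z \<bullet> normal z"

text \<open>The density as a function of \<open>Q = |n|\<^sup>2\<close> and \<open>M = n\<^sub>3\<^sup>2\<close>, both polynomials in \<open>z\<close>.\<close>
definition density_profile :: "real \<Rightarrow> real \<Rightarrow> real \<Rightarrow> real" where
  "density_profile b Q M = 2 * Q * sqrt Q / ((2 + b\<^sup>2) * Q - b\<^sup>2 * M)"

text \<open>The partial derivative of \<open>density_profile\<close> with respect to \<open>Q\<close>.\<close>
definition profile_slope :: "real \<Rightarrow> real \<Rightarrow> real \<Rightarrow> real" where
  "profile_slope b Q M = sqrt Q * ((2 + b\<^sup>2) * Q - 3 * b\<^sup>2 * M) / ((2 + b\<^sup>2) * Q - b\<^sup>2 * M)\<^sup>2"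

lemma BH_density_eq_profile:
  assumes "\<bar>b\<bar> < 1" and "normal z \<noteq> 0"
  shows "BH_density b z = density_profile b (sq_normal z) ((normal z $ 3)\<^sup>2)"
  by (simp add: BH_density_eq[OF assms] density_profile_def sq_normal_def power2_norm_eq_inner[symmetric]
      power3_eq_cube power2_eq_square)

lemma density_denominator_pos:
  fixes b Q M :: real
  assumes "Q > 0" and "M \<le> Q"
  shows "0 < (2 + b\<^sup>2) * Q - b\<^sup>2 * M"
proof -
  have "b\<^sup>2 * M \<le> b\<^sup>2 * Q" using assms by (intro mult_left_mono) auto
  then show ?thesis using assms by (simp add: distrib_right)
qed

lemma sq_normal_eq: "sq_normal z = (normal z $ 1)\<^sup>2 + (normal z $ 2)\<^sup>2 + (normal z $ 3)\<^sup>2"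
  by (simp add: sq_normal_def inner_vec_def sum_3 power2_eq_square)

lemma DERIV_density_profile:
  assumes q: "(q has_real_derivative q') (at t)" and "q t > 0" and "(2 + b\<^sup>2) * q t - b\<^sup>2 * M > 0"
  shows "((\<lambda>t. density_profile b (q t) M) has_real_derivative profile_slope b (q t) M * q') (at t)"
proof -
  define s K where "s = sqrt (q t)" and "K = (2 + b\<^sup>2) * q t - b\<^sup>2 * M"
  have s: "s > 0" "q t = s\<^sup>2" and K: "K > 0" using assms by (simp_all add: s_def K_def)
  have "((\<lambda>t. 2 * q t * sqrt (q t)) has_real_derivative 2 * q t * (inverse s / 2 * q') + 2 * q' * s) (at t)"
    using \<open>q t > 0\<close> unfolding s_def by (intro DERIV_mult' DERIV_cmult q DERIV_chain2[OF DERIV_real_sqrt])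
  also have "2 * q t * (inverse s / 2 * q') + 2 * q' * s = 3 * s * q'"
    using s(1) by (simp add: s(2) field_simps power2_eq_square)
  finally have "((\<lambda>t. 2 * q t * sqrt (q t) / ((2 + b\<^sup>2) * q t - b\<^sup>2 * M)) has_real_derivative
     (3 * s * q' * K - 2 * q t * s * ((2 + b\<^sup>2) * q' - 0)) / (K * K)) (at t)"
    unfolding K_def s_def using K unfolding K_def
    by (intro DERIV_divide DERIV_diff DERIV_cmult q DERIV_const) auto
  moreover have "3 * s * q' * K - 2 * q t * s * ((2 + b\<^sup>2) * q' - 0) = s * ((2 + b\<^sup>2) * q t - 3 * b\<^sup>2 * M) * q'"
    by (simp add: K_def algebra_simps)
  ultimately show ?thesis
    unfolding density_profile_def profile_slope_def s_def[symmetric] K_def[symmetric]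
    by (simp add: power2_eq_square)
qed

text \<open>Naming the denominator \<open>K\<close> (before squaring) and the linear numerator \<open>L\<close> of the slope keeps
  the second derivatives of the profile short: up to \<open>1 / sqrt Q\<close> they are rational.\<close>
lemma DERIV_profile_slope:
  assumes q: "(q has_real_derivative q') (at t)" and m: "(m has_real_derivative m') (at t)"
    and Q: "q t = Q" "Q > 0" and M: "m t = M"
    and K: "K = (2 + b\<^sup>2) * Q - b\<^sup>2 * M" "K > 0" and L: "L = (2 + b\<^sup>2) * Q - 3 * b\<^sup>2 * M"
  shows "((\<lambda>t. profile_slope b (q t) (m t)) has_real_derivative
     ((L * K / 2 + (2 + b\<^sup>2) * Q * (K - 2 * L)) * q' + Q * b\<^sup>2 * (2 * L - 3 * K) * m') / (sqrt Q * K ^ 3)) (at t)"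
proof -
  define s where "s = sqrt Q"
  have s: "s > 0" "Q = s\<^sup>2" using Q by (simp_all add: s_def)
  have n: "((\<lambda>t. sqrt (q t) * ((2 + b\<^sup>2) * q t - 3 * b\<^sup>2 * m t)) has_real_derivative
      s * ((2 + b\<^sup>2) * q' - 3 * b\<^sup>2 * m') + (inverse s / 2 * q') * L) (at t)"
    unfolding s_def L using Q(2) unfolding M[symmetric] Q(1)[symmetric] 
    by (intro DERIV_mult' DERIV_diff DERIV_cmult q m DERIV_chain2[OF DERIV_real_sqrt])
  have d: "((\<lambda>t. ((2 + b\<^sup>2) * q t - b\<^sup>2 * m t)\<^sup>2) has_real_derivative
      of_nat 2 * (((2 + b\<^sup>2) * q' - b\<^sup>2 * m') * K ^ (2 - Suc 0))) (at t)"
    unfolding K M[symmetric] Q(1)[symmetric] by (intro DERIV_power DERIV_diff DERIV_cmult q m)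
  have "((s * ((2 + b\<^sup>2) * q' - 3 * b\<^sup>2 * m') + (inverse s / 2 * q') * L) * K\<^sup>2
       - s * L * (of_nat 2 * (((2 + b\<^sup>2) * q' - b\<^sup>2 * m') * K ^ (2 - Suc 0)))) / (K\<^sup>2 * K\<^sup>2)
     = ((L * K / 2 + (2 + b\<^sup>2) * Q * (K - 2 * L)) * q' + Q * b\<^sup>2 * (2 * L - 3 * K) * m') / (s * K ^ 3)" (is "?X = ?Y")
    using s(1) K(2) unfolding s(2) by (simp add: divide_simps) (simp add: algebra_simps power2_eq_square power3_eq_cube power4_eq_xxxx)
  moreover have "((\<lambda>t. profile_slope b (q t) (m t)) has_real_derivative ?X) (at t)"
    unfolding profile_slope_def using DERIV_divide[OF n d] K(2)
    by (simp add: Q(1) M K(1)[symmetric] L[symmetric] s_def[symmetric])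
  ultimately show ?thesis
    unfolding s_def by metis
qed

lemma eventually_normal_nonzero:
  assumes "normal z \<noteq> 0"
  shows "\<forall>\<^sub>F t in nhds 0. normal (z + t *\<^sub>R e) \<noteq> 0"
proof -
  have "continuous_on UNIV (\<lambda>t. normal (z + t *\<^sub>R e))"
    unfolding normal_def column_def by (intro continuous_intros continuous_on_cross)
  then have "open ((\<lambda>t. normal (z + t *\<^sub>R e)) -` (- {0}))"
    by (intro open_vimage) auto
  then show ?thesis
    using assms by (auto simp: eventually_nhds intro!: exI[of _ "(\<lambda>t. normal (z + t *\<^sub>R e)) -` (- {0})"])
qed

text \<open>A change of the third row of \<open>z\<close> leaves \<open>n\<^sub>3\<close> fixed, so only the \<open>Q\<close>-derivative of the profile
  enters. The formula holds at all \<open>z\<close> of rank 2, as is needed to differentiate it once more.\<close>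
lemma BH_density_deriv:
  assumes b: "\<bar>b\<bar> < 1" and z: "normal z \<noteq> 0"
  shows "partial_deriv (mat_unit 3 1) (BH_density b) z =
      2 * profile_slope b (sq_normal z) ((normal z $ 3)\<^sup>2) * (normal z $ 2 * z $ 1 $ 2 - normal z $ 1 * z $ 2 $ 2)"
    and "partial_deriv (mat_unit 3 2) (BH_density b) z =
      2 * profile_slope b (sq_normal z) ((normal z $ 3)\<^sup>2) * (normal z $ 1 * z $ 2 $ 1 - normal z $ 2 * z $ 1 $ 1)"
proof -
  have pos: "sq_normal z > 0" "(2 + b\<^sup>2) * sq_normal z - b\<^sup>2 * (normal z $ 3)\<^sup>2 > 0"
  proof -
    show "sq_normal z > 0" using z by (simp add: sq_normal_def)
    moreover have "(normal z $ 3)\<^sup>2 \<le> sq_normal z" by (simp add: sq_normal_eq)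
    ultimately show "(2 + b\<^sup>2) * sq_normal z - b\<^sup>2 * (normal z $ 3)\<^sup>2 > 0"
      by (rule density_denominator_pos)
  qed
  have *: "partial_deriv e (BH_density b) z = profile_slope b (sq_normal z) ((normal z $ 3)\<^sup>2) * q'"
    if q: "((\<lambda>t. sq_normal (z + t *\<^sub>R e)) has_real_derivative q') (at 0)"
      and m: "\<And>t. normal (z + t *\<^sub>R e) $ 3 = normal z $ 3" for e q'
  proof -
    have "\<forall>\<^sub>F t in nhds 0. BH_density b (z + t *\<^sub>R e) = density_profile b (sq_normal (z + t *\<^sub>R e)) ((normal z $ 3)\<^sup>2)"
      using eventually_normal_nonzero[OF z, of e] by eventually_elim (simp add: BH_density_eq_profile[OF b] m)
    then have "partial_deriv e (BH_density b) z = deriv (\<lambda>t. density_profile b (sq_normal (z + t *\<^sub>R e)) ((normal z $ 3)\<^sup>2)) 0"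
      unfolding partial_deriv_def by (rule deriv_cong_ev) simp
    also have "\<dots> = profile_slope b (sq_normal z) ((normal z $ 3)\<^sup>2) * q'"
      using DERIV_density_profile[OF q, of b "(normal z $ 3)\<^sup>2"] pos by (intro DERIV_imp_deriv) simp
    finally show ?thesis .
  qed
  have quadratic: "((\<lambda>t. (n1 + t * d1)\<^sup>2 + (n2 + t * d2)\<^sup>2 + c) has_real_derivative 2 * (n1 * d1 + n2 * d2)) (at 0)"
    for n1 n2 d1 d2 c :: real
    by (auto intro!: derivative_eq_intros)
  have eq: "sq_normal (z + t *\<^sub>R mat_unit 3 1) =
      (normal z $ 1 + t * (- z $ 2 $ 2))\<^sup>2 + (normal z $ 2 + t * z $ 1 $ 2)\<^sup>2 + (normal z $ 3)\<^sup>2" for t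
    unfolding sq_normal_eq normal_nth by (simp add: axis_def algebra_simps)
  have "((\<lambda>t. sq_normal (z + t *\<^sub>R mat_unit 3 1)) has_real_derivative
      2 * (normal z $ 1 * (- z $ 2 $ 2) + normal z $ 2 * z $ 1 $ 2)) (at 0)"
    unfolding eq by (rule quadratic)
  then show "partial_deriv (mat_unit 3 1) (BH_density b) z =
      2 * profile_slope b (sq_normal z) ((normal z $ 3)\<^sup>2) * (normal z $ 2 * z $ 1 $ 2 - normal z $ 1 * z $ 2 $ 2)"
    by (subst *) (auto simp: normal_nth axis_def)
  have eq: "sq_normal (z + t *\<^sub>R mat_unit 3 2) =
      (normal z $ 1 + t * z $ 2 $ 1)\<^sup>2 + (normal z $ 2 + t * (- z $ 1 $ 1))\<^sup>2 + (normal z $ 3)\<^sup>2" for t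
    unfolding sq_normal_eq normal_nth by (simp add: axis_def algebra_simps)
  have "((\<lambda>t. sq_normal (z + t *\<^sub>R mat_unit 3 2)) has_real_derivative
      2 * (normal z $ 1 * z $ 2 $ 1 + normal z $ 2 * (- z $ 1 $ 1))) (at 0)"
    unfolding eq by (rule quadratic)
  then show "partial_deriv (mat_unit 3 2) (BH_density b) z =
      2 * profile_slope b (sq_normal z) ((normal z $ 3)\<^sup>2) * (normal z $ 1 * z $ 2 $ 1 - normal z $ 2 * z $ 1 $ 1)"
    by (subst *) (auto simp: normal_nth axis_def)
qed

definition graph_jacobian :: "real \<Rightarrow> real \<Rightarrow> real ^ 2 ^ 3" where
  "graph_jacobian p q = vector [vector [1, 0], vector [0, 1], vector [p, q]]"

text \<open>The coefficient of \<open>f''\<close> in the Euler-Lagrange equation, up to a common factor; that of \<open>g''\<close> is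
  the same with \<open>p\<close> and \<open>q\<close> exchanged.\<close>
definition euler_coeff :: "real \<Rightarrow> real \<Rightarrow> real \<Rightarrow> real" where
  "euler_coeff b p q =
     (1 + q\<^sup>2) * (2 + (2 + b\<^sup>2) * (p\<^sup>2 + q\<^sup>2)) * (2 * (1 - b\<^sup>2) + (2 + b\<^sup>2) * (p\<^sup>2 + q\<^sup>2))
     + 2 * b\<^sup>2 * p\<^sup>2 * (2 + 4 * b\<^sup>2 + (2 + b\<^sup>2) * (p\<^sup>2 + q\<^sup>2))"

lemma normal_graph_jacobian:
  "normal (graph_jacobian p q) = vector [- p, - q, 1]"
  by (simp add: vec_eq_iff forall_3 normal_nth graph_jacobian_def)

lemma normal_graph_jacobian_nonzero: "normal (graph_jacobian p q) \<noteq> 0"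
  by (auto simp: normal_graph_jacobian vec_eq_iff forall_3)

text \<open>The first derivatives of the density are products of the profile slope with a polynomial \<open>W\<close>.
  This is the product rule for them at a matrix whose normal is that of a graph.\<close>
lemma slope_product_deriv:
  assumes z: "normal z = vector [- p, - q, 1]"
    and Dz: "\<And>z. normal z \<noteq> 0 \<Longrightarrow> D z = 2 * profile_slope b (sq_normal z) ((normal z $ 3)\<^sup>2) * W z"
    and dq: "((\<lambda>t. sq_normal (z + t *\<^sub>R e)) has_real_derivative q') (at 0)"
    and dm: "((\<lambda>t. (normal (z + t *\<^sub>R e) $ 3)\<^sup>2) has_real_derivative m') (at 0)"
    and dw: "((\<lambda>t. W (z + t *\<^sub>R e)) has_real_derivative w') (at 0)"
    and Q: "Q = 1 + p\<^sup>2 + q\<^sup>2" and K: "K = (2 + b\<^sup>2) * Q - b\<^sup>2" and L: "L = (2 + b\<^sup>2) * Q - 3 * b\<^sup>2"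
  shows "partial_deriv e D z = 2 / (sqrt Q * K ^ 3) *
    (Q * L * K * w' + ((L * K / 2 + (2 + b\<^sup>2) * Q * (K - 2 * L)) * q' + Q * b\<^sup>2 * (2 * L - 3 * K) * m') * W z)"
proof -
  have z0: "normal z \<noteq> 0" by (auto simp: z vec_eq_iff forall_3)
  have Qz: "sq_normal z = Q" "(normal z $ 3)\<^sup>2 = 1"
    by (simp_all add: sq_normal_eq z Q)
  have pos: "Q > 0" "K > 0"
  proof -
    show "Q > 0" by (simp add: Q add_pos_nonneg)
    then show "K > 0" unfolding K using density_denominator_pos[of Q 1 b] by (simp add: Q)
  qed
  define S' where "S' = ((L * K / 2 + (2 + b\<^sup>2) * Q * (K - 2 * L)) * q' + Q * b\<^sup>2 * (2 * L - 3 * K) * m') / (sqrt Q * K ^ 3)"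
  have S: "((\<lambda>t. profile_slope b (sq_normal (z + t *\<^sub>R e)) ((normal (z + t *\<^sub>R e) $ 3)\<^sup>2)) has_real_derivative S') (at 0)"
    unfolding S'_def using pos
    by (intro DERIV_profile_slope[OF dq dm, where M = 1]) (simp_all add: Qz K L)
  have S0: "profile_slope b Q 1 = sqrt Q * L / K\<^sup>2"
    by (simp add: profile_slope_def K L)
  have "\<forall>\<^sub>F t in nhds 0. D (z + t *\<^sub>R e)
      = 2 * (profile_slope b (sq_normal (z + t *\<^sub>R e)) ((normal (z + t *\<^sub>R e) $ 3)\<^sup>2) * W (z + t *\<^sub>R e))"
    using eventually_normal_nonzero[OF z0, of e] by eventually_elim (simp add: Dz)
  then have "partial_deriv e D z = deriv (\<lambda>t. 2 * (profile_slope b (sq_normal (z + t *\<^sub>R e))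
      ((normal (z + t *\<^sub>R e) $ 3)\<^sup>2) * W (z + t *\<^sub>R e))) 0"
    unfolding partial_deriv_def by (rule deriv_cong_ev) simp
  also have "\<dots> = 2 * (profile_slope b (sq_normal (z + 0 *\<^sub>R e)) ((normal (z + 0 *\<^sub>R e) $ 3)\<^sup>2) * w' + S' * W (z + 0 *\<^sub>R e))"
    by (intro DERIV_imp_deriv DERIV_cmult DERIV_mult' S dw)
  also have "\<dots> = 2 * (sqrt Q * L / K\<^sup>2 * w' + S' * W z)"
    by (simp add: Qz S0)
  also have "sqrt Q * L / K\<^sup>2 = Q * L * K / (sqrt Q * K ^ 3)"
    using pos by (simp add: divide_simps power2_eq_square power3_eq_cube)
  finally have "partial_deriv e D z = 2 * (Q * L * K / (sqrt Q * K ^ 3) * w' + S' * W z)" .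
  moreover have "2 * (x / d * w' + y / d * W z) = 2 / d * (x * w' + y * W z)" for x y d
    by (simp add: add_divide_distrib distrib_left)
  ultimately show ?thesis
    unfolding S'_def by simp
qed

text \<open>That the three components are proportional to those of \<open>n\<close> reflects the invariance of the area
  under reparametrisation: it makes the Euler-Lagrange covector annihilate the tangent plane.\<close>
lemma BH_density_second_deriv:
  fixes b p q :: real
  assumes b: "\<bar>b\<bar> < 1"
  defines "z \<equiv> graph_jacobian p q"
  defines "Q \<equiv> 1 + p\<^sup>2 + q\<^sup>2"
  defines "c \<equiv> 2 / (sqrt Q * ((2 + b\<^sup>2) * Q - b\<^sup>2) ^ 3)"
  shows "partial_deriv (mat_unit i 1) (partial_deriv (mat_unit 3 1) (BH_density b)) z
      = c * euler_coeff b p q * normal z $ i"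
    and "partial_deriv (mat_unit i 2) (partial_deriv (mat_unit 3 2) (BH_density b)) z
      = c * euler_coeff b q p * normal z $ i"
proof -
  have nz: "normal z = vector [- p, - q, 1]"
    by (simp add: z_def normal_graph_jacobian)
  have zs: "z $ 1 $ 1 = 1" "z $ 1 $ 2 = 0" "z $ 2 $ 1 = 0" "z $ 2 $ 2 = 1" "z $ 3 $ 1 = p" "z $ 3 $ 2 = q"
    by (simp_all add: z_def graph_jacobian_def)
  define K where "K = (2 + b\<^sup>2) * Q - b\<^sup>2"
  define L where "L = (2 + b\<^sup>2) * Q - 3 * b\<^sup>2"
  define E where "E w' q' m' w = Q * L * K * w'
      + ((L * K / 2 + (2 + b\<^sup>2) * Q * (K - 2 * L)) * q' + Q * b\<^sup>2 * (2 * L - 3 * K) * m') * w" for w' q' m' w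
  have KL: "K = 2 + (2 + b\<^sup>2) * (p\<^sup>2 + q\<^sup>2)" "L = 2 * (1 - b\<^sup>2) + (2 + b\<^sup>2) * (p\<^sup>2 + q\<^sup>2)"
    by (simp_all add: K_def L_def Q_def algebra_simps)
  \<comment> \<open>With \<open>X = (2 + b\<^sup>2) Q\<close> one has \<open>K = X - b\<^sup>2\<close> and \<open>L = X - 3 b\<^sup>2\<close>; after adding \<open>L K\<close>
    the squares of \<open>X\<close> cancel, which leaves the second summand of the coefficient.\<close>
  have twist: "L * K + (2 + b\<^sup>2) * Q * (2 * K - 4 * L) = 2 * b\<^sup>2 * (2 + 4 * b\<^sup>2 + (2 + b\<^sup>2) * (p\<^sup>2 + q\<^sup>2)) - L * K"
    unfolding K_def L_def Q_def by (simp add: power2_eq_square algebra_simps)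
  have twist': "Q * (2 * L - 3 * K) = - Q * (2 + 4 * b\<^sup>2 + (2 + b\<^sup>2) * (p\<^sup>2 + q\<^sup>2))"
    unfolding K_def L_def Q_def by (simp add: power2_eq_square algebra_simps)
  define R where "R = 2 + 4 * b\<^sup>2 + (2 + b\<^sup>2) * (p\<^sup>2 + q\<^sup>2)"
  have E: "E w' q' m' w = Q * L * K * w' + ((b\<^sup>2 * R - L * K / 2) * q' - Q * b\<^sup>2 * R * m') * w" for w' q' m' w
  proof -
    have "L * K / 2 + (2 + b\<^sup>2) * Q * (K - 2 * L) = b\<^sup>2 * R - L * K / 2"
      using twist by (simp add: R_def algebra_simps)
    moreover have "Q * b\<^sup>2 * (2 * L - 3 * K) = - (Q * b\<^sup>2 * R)"
      using arg_cong[OF twist', of "\<lambda>x. b\<^sup>2 * x"] by (simp add: R_def mult_ac)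
    ultimately show ?thesis
      unfolding E_def by simp
  qed
  have \<Lambda>: "euler_coeff b p q = (1 + q\<^sup>2) * K * L + 2 * b\<^sup>2 * p\<^sup>2 * R"
    "euler_coeff b q p = (1 + p\<^sup>2) * K * L + 2 * b\<^sup>2 * q\<^sup>2 * R"
    by (simp_all add: euler_coeff_def KL R_def add.commute)
  have D1: "partial_deriv e (partial_deriv (mat_unit 3 1) (BH_density b)) z = c * E w' q' m' p"
    if "((\<lambda>t. sq_normal (z + t *\<^sub>R e)) has_real_derivative q') (at 0)"
      "((\<lambda>t. (normal (z + t *\<^sub>R e) $ 3)\<^sup>2) has_real_derivative m') (at 0)"
      "((\<lambda>t. normal (z + t *\<^sub>R e) $ 2 * (z + t *\<^sub>R e) $ 1 $ 2 - normal (z + t *\<^sub>R e) $ 1 * (z + t *\<^sub>R e) $ 2 $ 2)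
         has_real_derivative w') (at 0)" for e q' m' w'
    using slope_product_deriv[OF nz BH_density_deriv(1)[OF b] that meta_eq_to_obj_eq[OF Q_def] K_def L_def]
    by (simp add: c_def E_def K_def[symmetric] nz zs)
  have D2: "partial_deriv e (partial_deriv (mat_unit 3 2) (BH_density b)) z = c * E w' q' m' q"
    if "((\<lambda>t. sq_normal (z + t *\<^sub>R e)) has_real_derivative q') (at 0)"
      "((\<lambda>t. (normal (z + t *\<^sub>R e) $ 3)\<^sup>2) has_real_derivative m') (at 0)"
      "((\<lambda>t. normal (z + t *\<^sub>R e) $ 1 * (z + t *\<^sub>R e) $ 2 $ 1 - normal (z + t *\<^sub>R e) $ 2 * (z + t *\<^sub>R e) $ 1 $ 1)
         has_real_derivative w') (at 0)" for e q' m' w'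
    using slope_product_deriv[OF nz BH_density_deriv(2)[OF b] that meta_eq_to_obj_eq[OF Q_def] K_def L_def]
    by (simp add: c_def E_def K_def[symmetric] nz zs)
  note poly = sq_normal_eq normal_nth axis_def zs
  have "partial_deriv (mat_unit 1 1) (partial_deriv (mat_unit 3 1) (BH_density b)) z = c * E 0 (2 * (1 + q\<^sup>2)) 2 p"
    by (rule D1) (auto simp: poly power2_eq_square intro!: derivative_eq_intros)
  also have "E 0 (2 * (1 + q\<^sup>2)) 2 p = euler_coeff b p q * (- p)"
    unfolding E \<Lambda> Q_def by (simp add: power2_eq_square algebra_simps)
  finally have 11: "partial_deriv (mat_unit 1 1) (partial_deriv (mat_unit 3 1) (BH_density b)) z
      = c * (euler_coeff b p q * (- p))" .
  have "partial_deriv (mat_unit 2 1) (partial_deriv (mat_unit 3 1) (BH_density b)) z = c * E (- q) (- 2 * p * q) 0 p"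
    by (rule D1) (auto simp: poly power2_eq_square intro!: derivative_eq_intros)
  also have "E (- q) (- 2 * p * q) 0 p = euler_coeff b p q * (- q)"
    unfolding E \<Lambda> Q_def by (simp add: power2_eq_square algebra_simps)
  finally have 21: "partial_deriv (mat_unit 2 1) (partial_deriv (mat_unit 3 1) (BH_density b)) z
      = c * (euler_coeff b p q * (- q))" .
  have "partial_deriv (mat_unit 3 1) (partial_deriv (mat_unit 3 1) (BH_density b)) z = c * E 1 (2 * p) 0 p"
    by (rule D1) (auto simp: poly power2_eq_square intro!: derivative_eq_intros)
  also have "E 1 (2 * p) 0 p = euler_coeff b p q"
    unfolding E \<Lambda> Q_def by (simp add: power2_eq_square algebra_simps)
  finally have 31: "partial_deriv (mat_unit 3 1) (partial_deriv (mat_unit 3 1) (BH_density b)) z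
      = c * euler_coeff b p q" .
  show "partial_deriv (mat_unit i 1) (partial_deriv (mat_unit 3 1) (BH_density b)) z
      = c * euler_coeff b p q * normal z $ i"
    using exhaust_3[of i] 11 21 31 by (auto simp: nz)
  have "partial_deriv (mat_unit 1 2) (partial_deriv (mat_unit 3 2) (BH_density b)) z = c * E (- p) (- 2 * p * q) 0 q"
    by (rule D2) (auto simp: poly power2_eq_square intro!: derivative_eq_intros)
  also have "E (- p) (- 2 * p * q) 0 q = euler_coeff b q p * (- p)"
    unfolding E \<Lambda> Q_def by (simp add: power2_eq_square algebra_simps)
  finally have 12: "partial_deriv (mat_unit 1 2) (partial_deriv (mat_unit 3 2) (BH_density b)) z
      = c * (euler_coeff b q p * (- p))" .
  have "partial_deriv (mat_unit 2 2) (partial_deriv (mat_unit 3 2) (BH_density b)) z = c * E 0 (2 * (1 + p\<^sup>2)) 2 q"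
    by (rule D2) (auto simp: poly power2_eq_square intro!: derivative_eq_intros)
  also have "E 0 (2 * (1 + p\<^sup>2)) 2 q = euler_coeff b q p * (- q)"
    unfolding E \<Lambda> Q_def by (simp add: power2_eq_square algebra_simps)
  finally have 22: "partial_deriv (mat_unit 2 2) (partial_deriv (mat_unit 3 2) (BH_density b)) z
      = c * (euler_coeff b q p * (- q))" .
  have "partial_deriv (mat_unit 3 2) (partial_deriv (mat_unit 3 2) (BH_density b)) z = c * E 1 (2 * q) 0 q"
    by (rule D2) (auto simp: poly power2_eq_square intro!: derivative_eq_intros)
  also have "E 1 (2 * q) 0 q = euler_coeff b q p"
    unfolding E \<Lambda> Q_def by (simp add: power2_eq_square algebra_simps)
  finally have 32: "partial_deriv (mat_unit 3 2) (partial_deriv (mat_unit 3 2) (BH_density b)) z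
      = c * euler_coeff b q p" .
  show "partial_deriv (mat_unit i 2) (partial_deriv (mat_unit 3 2) (BH_density b)) z
      = c * euler_coeff b q p * normal z $ i"
    using exhaust_3[of i] 12 22 32 by (auto simp: nz)
qed

section \<open>Minimal translation surfaces\<close>

lemma smooth_onD:
  assumes "smooth_on h S" and "t \<in> S"
  shows "h field_differentiable at t" "deriv h field_differentiable at t" "isCont (deriv (deriv h)) t"
proof -
  have *: "(deriv ^^ n) h field_differentiable at t" for n
    using assms by (simp add: smooth_on_def)
  show "h field_differentiable at t" using *[of 0] by simp
  show "deriv h field_differentiable at t" using *[of 1] by simp
  show "isCont (deriv (deriv h)) t"
    using *[of 2] field_differentiable_imp_continuous_at by (simp add: numeral_2_eq_2)
qed

text \<open>The parameter domain is open, so the formula of the Jacobian matrix holds near \<open>x\<close> and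
  may be differentiated.\<close>
lemma second_partials_translation_surface:
  assumes "open U" and "x \<in> U" and f: "smooth_on f ((\<lambda>x. x $ 1) ` U)" and g: "smooth_on g ((\<lambda>x. x $ 2) ` U)"
  shows "partial_deriv (axis \<epsilon> 1) (partial_deriv (axis \<eta> 1) (\<lambda>u. translation_surface f g u $ j)) x =
    (if j = 3 \<and> \<epsilon> = \<eta> then if \<epsilon> = 1 then deriv (deriv f) (x $ 1) else deriv (deriv g) (x $ 2) else 0)"
proof -
  have J: "partial_deriv (axis \<eta> 1) (\<lambda>u. translation_surface f g u $ j) u
      = graph_jacobian (deriv f (u $ 1)) (deriv g (u $ 2)) $ j $ \<eta>" if "u \<in> U" for u
  proof -
    have "partial_deriv (axis \<eta> 1) (\<lambda>u. translation_surface f g u $ j) u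
        = jacobian_matrix (translation_surface f g) u $ j $ \<eta>"
      by (simp add: jacobian_matrix_def)
    then show ?thesis
      using that smooth_onD(1)[OF f] smooth_onD(1)[OF g]
      by (simp add: jacobian_translation_surface graph_jacobian_def)
  qed
  have "((\<lambda>t. x + t *\<^sub>R axis \<epsilon> 1) \<longlongrightarrow> x + 0 *\<^sub>R axis \<epsilon> 1) (nhds 0)"
    by (intro tendsto_intros filterlim_ident)
  then have "\<forall>\<^sub>F t in nhds 0. x + t *\<^sub>R axis \<epsilon> 1 \<in> U"
    using assms(1,2) by (intro topological_tendstoD[where S = U]) auto
  then have "\<forall>\<^sub>F t in nhds 0. partial_deriv (axis \<eta> 1) (\<lambda>u. translation_surface f g u $ j) (x + t *\<^sub>R axis \<epsilon> 1)
      = graph_jacobian (deriv f ((x + t *\<^sub>R axis \<epsilon> 1) $ 1)) (deriv g ((x + t *\<^sub>R axis \<epsilon> 1) $ 2)) $ j $ \<eta>"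
    by eventually_elim (rule J)
  then have eq: "partial_deriv (axis \<epsilon> 1) (partial_deriv (axis \<eta> 1) (\<lambda>u. translation_surface f g u $ j)) x
    = deriv (\<lambda>t. graph_jacobian (deriv f ((x + t *\<^sub>R axis \<epsilon> 1) $ 1)) (deriv g ((x + t *\<^sub>R axis \<epsilon> 1) $ 2)) $ j $ \<eta>) 0"
    unfolding partial_deriv_def[of "axis \<epsilon> 1"] by (rule deriv_cong_ev) simp
  have shift: "deriv (\<lambda>t. deriv h (a + t)) 0 = deriv (deriv h) a" if "deriv h field_differentiable at a" for h :: "real \<Rightarrow> real" and a
    using DERIV_at_within_shift[of "deriv h" "deriv (deriv h) a" a 0 UNIV] that
    by (intro DERIV_imp_deriv) (simp add: field_differentiable_derivI)
  have "deriv f field_differentiable at (x $ 1)" "deriv g field_differentiable at (x $ 2)"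
    using smooth_onD(2)[OF f] smooth_onD(2)[OF g] assms(2) by auto
  note shift[OF this(1)] shift[OF this(2)]
  then show ?thesis
    unfolding eq using exhaust_2[of \<epsilon>] exhaust_2[of \<eta>] exhaust_3[of j]
    by (auto simp: graph_jacobian_def axis_def)
qed

text \<open>The factor \<open>c\<close> does not depend on the vector field, so the mean curvature is, up to a nonzero
  number, the Euler-Lagrange expression times the inner product of the field with \<open>n\<close>.\<close>
lemma mean_curvature_translation_surface:
  fixes b :: real
  assumes b: "\<bar>b\<bar> < 1" and U: "open U" "x \<in> U"
    and f: "smooth_on f ((\<lambda>x. x $ 1) ` U)" and g: "smooth_on g ((\<lambda>x. x $ 2) ` U)"
  defines "p \<equiv> deriv f (x $ 1)" and "q \<equiv> deriv g (x $ 2)"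
  obtains c where "c \<noteq> 0"
    and "\<And>v. mean_curvature b (translation_surface f g) v x =
      c * (euler_coeff b p q * deriv (deriv f) (x $ 1) + euler_coeff b q p * deriv (deriv g) (x $ 2)) *
      (normal (graph_jacobian p q) \<bullet> v x)"
proof -
  define Q where "Q = 1 + p\<^sup>2 + q\<^sup>2"
  define K where "K = (2 + b\<^sup>2) * Q - b\<^sup>2"
  define c where "c = 2 / (sqrt Q * K ^ 3)"
  have "Q > 0" by (simp add: Q_def add_pos_nonneg)
  moreover have "K > 0" using density_denominator_pos[of Q 1 b] \<open>Q > 0\<close> by (simp add: K_def Q_def)
  ultimately have "c \<noteq> 0" by (simp add: c_def)
  let ?J = "graph_jacobian p q"
  have J: "jacobian_matrix (translation_surface f g) x = ?J"
    using smooth_onD(1)[OF f] smooth_onD(1)[OF g] U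
    by (simp add: jacobian_translation_surface graph_jacobian_def p_def q_def)
  have "BH_density b ?J = 2 * sqrt Q ^ 3 / K"
    unfolding BH_density_eq[OF b normal_graph_jacobian_nonzero]
    by (simp add: normal_graph_jacobian norm_vec_def L2_set_def sum_3 Q_def K_def add_ac)
  \<comment> \<open>The density is positive, so dividing by it is harmless.\<close>
  then have F: "1 / BH_density b ?J * c \<noteq> 0"
    using \<open>c \<noteq> 0\<close> \<open>Q > 0\<close> \<open>K > 0\<close> by simp
  note second = BH_density_second_deriv[OF b, where p = p and q = q, folded Q_def, folded K_def, folded c_def]
  have "mean_curvature b (translation_surface f g) v x =
      1 / BH_density b ?J * c *
      (euler_coeff b p q * deriv (deriv f) (x $ 1) + euler_coeff b q p * deriv (deriv g) (x $ 2)) *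
      (normal ?J \<bullet> v x)" for v
    unfolding mean_curvature_def J
    by (simp add: second_partials_translation_surface[OF U f g] sum_3[where 'a = real] sum_2 second inner_vec_def
        algebra_simps)
  with F show thesis by (rule that)
qed

text \<open>The constant field along the third axis detects the Euler-Lagrange expression, because a graph is
  nowhere tangent to that axis.\<close>
lemma minimal_translation_surface_iff:
  assumes b: "\<bar>b\<bar> < 1" and U: "open U"
    and f: "smooth_on f ((\<lambda>x. x $ 1) ` U)" and g: "smooth_on g ((\<lambda>x. x $ 2) ` U)"
  shows "minimal_on b U (translation_surface f g) \<longleftrightarrow>
    (\<forall>x\<in>U. euler_coeff b (deriv f (x $ 1)) (deriv g (x $ 2)) * deriv (deriv f) (x $ 1)
          + euler_coeff b (deriv g (x $ 2)) (deriv f (x $ 1)) * deriv (deriv g) (x $ 2) = 0)"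
  unfolding minimal_on_def
proof (intro iffI ballI allI)
  fix x assume m: "\<forall>v. \<forall>x\<in>U. mean_curvature b (translation_surface f g) v x = 0" and "x \<in> U"
  let ?p = "deriv f (x $ 1)" and ?q = "deriv g (x $ 2)"
  obtain c where "c \<noteq> 0" and "\<And>v. mean_curvature b (translation_surface f g) v x =
      c * (euler_coeff b ?p ?q * deriv (deriv f) (x $ 1) + euler_coeff b ?q ?p * deriv (deriv g) (x $ 2)) *
      (normal (graph_jacobian ?p ?q) \<bullet> v x)"
    using mean_curvature_translation_surface[OF b U \<open>x \<in> U\<close> f g] by metis
  from \<open>c \<noteq> 0\<close> this(2)[of "\<lambda>_. axis 3 1"] show "euler_coeff b ?p ?q * deriv (deriv f) (x $ 1) + euler_coeff b ?q ?p * deriv (deriv g) (x $ 2) = 0"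
    using m \<open>x \<in> U\<close> by (simp add: normal_graph_jacobian inner_axis)
next
  fix v x assume "\<forall>x\<in>U. euler_coeff b (deriv f (x $ 1)) (deriv g (x $ 2)) * deriv (deriv f) (x $ 1)
          + euler_coeff b (deriv g (x $ 2)) (deriv f (x $ 1)) * deriv (deriv g) (x $ 2) = 0" and "x \<in> U"
  then show "mean_curvature b (translation_surface f g) v x = 0"
    using mean_curvature_translation_surface[OF b U \<open>x \<in> U\<close> f g] by (metis mult_zero_left mult_zero_right)
qed

section \<open>Equations that only affine functions satisfy\<close>

lemma real_polynomial_function_eqI:
  fixes h k :: "real \<Rightarrow> real"
  assumes "real_polynomial_function h" and "real_polynomial_function k"
    and "infinite S" and "\<And>t. t \<in> S \<Longrightarrow> h t = k t"
  shows "h t = k t"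
proof -
  have "real_polynomial_function (\<lambda>t. h t - k t)"
    using assms by (intro real_polynomial_function_diff)
  then obtain a n where a: "(\<lambda>t. h t - k t) = (\<lambda>t. \<Sum>i\<le>n. a i * t ^ i)"
    unfolding real_polynomial_function_iff_sum by auto
  have "S \<subseteq> {t. (\<Sum>i\<le>n. a i * t ^ i) = 0}"
    using assms(4) fun_cong[OF a] by (auto simp: algebra_simps)
  then have "infinite {t. (\<Sum>i\<le>n. a i * t ^ i) = 0}"
    using assms(3) finite_subset by blast
  then have "\<forall>i\<le>n. a i = 0"
    using polyfun_rootbound by blast
  then show ?thesis
    using fun_cong[OF a, of t] by simp
qed

text \<open>Where nothing vanishes this says that \<open>l p q / l q p\<close> is a function of \<open>p\<close> times a function of
  \<open>q\<close>. Clearing denominators in the cross-ratio form makes it a polynomial identity.\<close>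
definition separable_quotient :: "(real \<Rightarrow> real \<Rightarrow> real) \<Rightarrow> real set \<Rightarrow> real set \<Rightarrow> bool" where
  "separable_quotient l P R \<longleftrightarrow> (\<forall>p\<in>P. \<forall>p0\<in>P. \<forall>q\<in>R. \<forall>q0\<in>R.
     l p q * l p0 q0 * (l q0 p * l q p0) = l q p * l q0 p0 * (l p q0 * l p0 q))"

text \<open>A polynomial identity in one variable extends from an infinite set to the whole line; the four
  variables are released one after the other.\<close>
lemma separable_quotient_extend:
  assumes l1: "\<And>q. real_polynomial_function (\<lambda>p. l p q)" and l2: "\<And>p. real_polynomial_function (l p)"
    and P: "infinite P" and R: "infinite R" and sep: "separable_quotient l P R"
  shows "separable_quotient l UNIV UNIV"
proof -
  note intros = real_polynomial_function.intros(4) l1 l2 real_polynomial_function.intros(2)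
  have 1: "l p q * l p0 q0 * (l q0 p * l q p0) = l q p * l q0 p0 * (l p q0 * l p0 q)"
    if "p0 \<in> P" "q \<in> R" "q0 \<in> R" for p p0 q q0
    by (rule real_polynomial_function_eqI[OF _ _ P, where t = p]; (intro intros)?)
      (use that sep in \<open>auto simp: separable_quotient_def\<close>)
  have 2: "l p q * l p0 q0 * (l q0 p * l q p0) = l q p * l q0 p0 * (l p q0 * l p0 q)"
    if "q \<in> R" "q0 \<in> R" for p p0 q q0
    by (rule real_polynomial_function_eqI[OF _ _ P, where t = p0]; (intro intros)?)
      (use that 1 in auto)
  have 3: "l p q * l p0 q0 * (l q0 p * l q p0) = l q p * l q0 p0 * (l p q0 * l p0 q)"
    if "q0 \<in> R" for p p0 q q0
    by (rule real_polynomial_function_eqI[OF _ _ R, where t = q]; (intro intros)?)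
      (use that 2 in auto)
  have "l p q * l p0 q0 * (l q0 p * l q p0) = l q p * l q0 p0 * (l p q0 * l p0 q)" for p p0 q q0
    by (rule real_polynomial_function_eqI[OF _ _ R, where t = q0]; (intro intros)?)
      (use 3 in auto)
  then show ?thesis
    unfolding separable_quotient_def by blast
qed

text \<open>The image of the interval is connected; if finite, it would be one point and \<open>h'\<close> constant
  near \<open>a\<close>.\<close>
lemma infinite_deriv_image:
  fixes h :: "real \<Rightarrow> real"
  assumes "d > 0" and diff: "\<And>t. \<bar>t - a\<bar> < d \<Longrightarrow> deriv h field_differentiable at t"
    and "deriv (deriv h) a \<noteq> 0"
  shows "infinite (deriv h ` {t. \<bar>t - a\<bar> < d})"
proof
  let ?I = "{t. \<bar>t - a\<bar> < d}"
  have I: "?I = ball a d" by (auto simp: dist_real_def)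
  assume "finite (deriv h ` ?I)"
  moreover have "connected (deriv h ` ?I)"
    using diff unfolding I
    by (intro connected_continuous_image connected_ball continuous_at_imp_continuous_on
        ballI field_differentiable_imp_continuous_at) (simp add: dist_real_def)
  moreover have "deriv h a \<in> deriv h ` ?I" using \<open>d > 0\<close> by simp
  ultimately have "deriv h ` ?I = {deriv h a}"
    using connected_finite_iff_sing by (metis empty_iff singletonD)
  then have const: "deriv h t = deriv h a" if "t \<in> ?I" for t
    using that by blast
  have "\<forall>\<^sub>F t in nhds a. t \<in> ?I"
    unfolding I using \<open>d > 0\<close> by (intro eventually_nhds_in_open) auto
  then have "\<forall>\<^sub>F t in nhds a. deriv h t = deriv h a"
    by eventually_elim (rule const)
  then have "deriv (deriv h) a = deriv (\<lambda>t. deriv h a) a"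
    by (rule deriv_cong_ev) simp
  then show False using assms(3) by simp
qed

lemma vec2_box_in_open:
  fixes U :: "(real ^ 2) set"
  assumes "open U" and "x \<in> U"
  obtains d where "d > 0" and "\<And>s t. \<bar>s - x $ 1\<bar> < d \<Longrightarrow> \<bar>t - x $ 2\<bar> < d \<Longrightarrow> vector [s, t] \<in> U"
proof -
  obtain e where e: "e > 0" "ball x e \<subseteq> U" using assms openE by blast
  show thesis
  proof
    show "e / 2 > 0" using e by simp
    fix s t assume st: "\<bar>s - x $ 1\<bar> < e / 2" "\<bar>t - x $ 2\<bar> < e / 2"
    have "norm (vector [s, t] - x) \<le> \<bar>s - x $ 1\<bar> + \<bar>t - x $ 2\<bar>"
      using norm_le_l1_cart[of "vector [s, t] - x"] by (simp add: sum_2)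
    then have "vector [s, t] \<in> ball x e" using st by (simp add: dist_norm norm_minus_commute)
    then show "vector [s, t] \<in> U" using e by blast
  qed
qed

text \<open>As \<open>l\<close> is positive, \<open>f''\<close> and \<open>g''\<close> vanish together. If both are nonzero at \<open>x\<close>, they are so in a
  box around \<open>x\<close>. The equation at the four corners \<open>(s, t)\<close>, \<open>(s0, t0)\<close>, \<open>(s, t0)\<close>, \<open>(s0, t)\<close> of
  a rectangle in the box contains each of the four second derivatives twice, so they cancel from the product
  of the four equations. What remains is a separation identity for \<open>l\<close> at the slopes, and
  nonvanishing second derivatives provide infinitely many slopes.\<close>
lemma separated_equation_iff:
  fixes l :: "real \<Rightarrow> real \<Rightarrow> real" and U :: "(real ^ 2) set"
  assumes U: "open U" and f: "smooth_on f ((\<lambda>x. x $ 1) ` U)" and g: "smooth_on g ((\<lambda>x. x $ 2) ` U)"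
    and l1: "\<And>q. real_polynomial_function (\<lambda>p. l p q)" and l2: "\<And>p. real_polynomial_function (l p)"
    and pos: "\<And>p q. l p q > 0" and not_sep: "\<not> separable_quotient l UNIV UNIV"
  shows "(\<forall>x\<in>U. l (deriv f (x $ 1)) (deriv g (x $ 2)) * deriv (deriv f) (x $ 1)
          + l (deriv g (x $ 2)) (deriv f (x $ 1)) * deriv (deriv g) (x $ 2) = 0) \<longleftrightarrow>
      (\<forall>x\<in>U. deriv (deriv f) (x $ 1) = 0 \<and> deriv (deriv g) (x $ 2) = 0)" (is "?eq \<longleftrightarrow> ?affine")
proof
  assume ?eq
  then have eq: "l (deriv f (x $ 1)) (deriv g (x $ 2)) * deriv (deriv f) (x $ 1)
      + l (deriv g (x $ 2)) (deriv f (x $ 1)) * deriv (deriv g) (x $ 2) = 0" if "x \<in> U" for x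
    using that by (rule bspec)
  show ?affine
  proof
    fix x assume "x \<in> U"
    show "deriv (deriv f) (x $ 1) = 0 \<and> deriv (deriv g) (x $ 2) = 0"
    proof (rule ccontr)
      assume not: "\<not> (deriv (deriv f) (x $ 1) = 0 \<and> deriv (deriv g) (x $ 2) = 0)"
      have nz: "deriv (deriv f) (x $ 1) \<noteq> 0" "deriv (deriv g) (x $ 2) \<noteq> 0"
        using not eq[OF \<open>x \<in> U\<close>] less_imp_neq[OF pos[of "deriv f (x $ 1)" "deriv g (x $ 2)"]]
          less_imp_neq[OF pos[of "deriv g (x $ 2)" "deriv f (x $ 1)"]]
        by auto
      obtain d0 where d0: "d0 > 0" and box: "\<And>s t. \<bar>s - x $ 1\<bar> < d0 \<Longrightarrow> \<bar>t - x $ 2\<bar> < d0 \<Longrightarrow> vector [s, t] \<in> U"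
        using vec2_box_in_open[OF U \<open>x \<in> U\<close>] by blast
      have "\<forall>\<^sub>F s in nhds (x $ 1). deriv (deriv f) s \<noteq> 0"
        using smooth_onD(3)[OF f, of "x $ 1"] nz(1) \<open>x \<in> U\<close>
        by (intro tendsto_imp_eventually_ne) (auto simp: isCont_def tendsto_at_iff_tendsto_nhds)
      then obtain d1 where d1: "d1 > 0" "\<And>s. \<bar>s - x $ 1\<bar> < d1 \<Longrightarrow> deriv (deriv f) s \<noteq> 0"
        by (auto simp: eventually_nhds_metric dist_real_def)
      have "\<forall>\<^sub>F s in nhds (x $ 2). deriv (deriv g) s \<noteq> 0"
        using smooth_onD(3)[OF g, of "x $ 2"] nz(2) \<open>x \<in> U\<close>
        by (intro tendsto_imp_eventually_ne) (auto simp: isCont_def tendsto_at_iff_tendsto_nhds)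
      then obtain d2 where d2: "d2 > 0" "\<And>s. \<bar>s - x $ 2\<bar> < d2 \<Longrightarrow> deriv (deriv g) s \<noteq> 0"
        by (auto simp: eventually_nhds_metric dist_real_def)
      define d where "d = min d0 (min d1 d2)"
      let ?I = "{s. \<bar>s - x $ 1\<bar> < d}" and ?J = "{t. \<bar>t - x $ 2\<bar> < d}"
      have "d > 0" using d0 d1 d2 by (simp add: d_def)
      have in_U: "vector [s, t] \<in> U" if "s \<in> ?I" "t \<in> ?J" for s t
        using that box by (simp add: d_def)
      have proj: "s \<in> (\<lambda>x. x $ 1) ` U" "t \<in> (\<lambda>x. x $ 2) ` U" if "s \<in> ?I" "t \<in> ?J" for s t
        using imageI[OF in_U[OF that], of "\<lambda>x. x $ 1"] imageI[OF in_U[OF that], of "\<lambda>x. x $ 2"] by simp_all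
      have "infinite (deriv f ` ?I)"
        by (rule infinite_deriv_image[OF \<open>d > 0\<close> smooth_onD(2)[OF f] nz(1)], rule proj(1)[of _ "x $ 2"])
          (use \<open>d > 0\<close> in simp_all)
      moreover have "infinite (deriv g ` ?J)"
        by (rule infinite_deriv_image[OF \<open>d > 0\<close> smooth_onD(2)[OF g] nz(2)], rule proj(2)[of "x $ 1"])
          (use \<open>d > 0\<close> in simp_all)
      moreover have "separable_quotient l (deriv f ` ?I) (deriv g ` ?J)"
        unfolding separable_quotient_def
      proof (intro ballI)
        fix p p0 q q0 assume "p \<in> deriv f ` ?I" "p0 \<in> deriv f ` ?I" "q \<in> deriv g ` ?J" "q0 \<in> deriv g ` ?J"
        then obtain s s0 t t0 where I: "s \<in> ?I" "s0 \<in> ?I" and J: "t \<in> ?J" "t0 \<in> ?J"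
          and pq: "p = deriv f s" "p0 = deriv f s0" "q = deriv g t" "q0 = deriv g t0"
          by (elim imageE) (rule that)
        let ?A = "deriv (deriv f) s" and ?A' = "deriv (deriv f) s0"
        let ?B = "deriv (deriv g) t" and ?B' = "deriv (deriv g) t0"
        have e: "l p q * ?A = - (l q p * ?B)" "l p0 q0 * ?A' = - (l q0 p0 * ?B')"
          "l q0 p * ?B' = - (l p q0 * ?A)" "l q p0 * ?B = - (l p0 q * ?A')"
          using eq[OF in_U[OF I(1) J(1)]] eq[OF in_U[OF I(2) J(2)]] eq[OF in_U[OF I(1) J(2)]] eq[OF in_U[OF I(2) J(1)]]
          unfolding vector_2 pq[symmetric] by linarith+
        have "(l p q * ?A) * (l p0 q0 * ?A') * ((l q0 p * ?B') * (l q p0 * ?B))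
          = (l q p * ?B) * (l q0 p0 * ?B') * ((l p q0 * ?A) * (l p0 q * ?A'))"
          by (simp only: e minus_mult_minus)
        then have "(l p q * l p0 q0 * (l q0 p * l q p0)) * (?A * ?A' * ?B * ?B')
          = (l q p * l q0 p0 * (l p q0 * l p0 q)) * (?A * ?A' * ?B * ?B')"
          by (simp only: mult_ac)
        moreover have "?A * ?A' * ?B * ?B' \<noteq> 0"
          using I J d1(2)[of s] d1(2)[of s0] d2(2)[of t] d2(2)[of t0] by (simp add: d_def)
        ultimately show "l p q * l p0 q0 * (l q0 p * l q p0) = l q p * l q0 p0 * (l p q0 * l p0 q)"
          by (rule mult_right_cancel[THEN iffD1, rotated])
      qed
      ultimately have "separable_quotient l UNIV UNIV"
        using separable_quotient_extend[of l "deriv f ` ?I" "deriv g ` ?J"] l1 l2 by blast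
      with not_sep show False ..
    qed
  qed
next
  assume ?affine
  then show ?eq by simp
qed

lemma coeffs_pos:
  assumes "\<bar>b\<bar> < 1"
  shows "coeff_lambda b p q > 0" and "euler_coeff b p q > 0"
proof -
  have b: "b\<^sup>2 < 1" using assms by (simp add: abs_square_less_1)
  have 1: "0 < (1 + q\<^sup>2) * (2 + (2 + b\<^sup>2) * (p\<^sup>2 + q\<^sup>2)) * (2 * (1 - b\<^sup>2) + (2 + b\<^sup>2) * (p\<^sup>2 + q\<^sup>2))"
    using b by (intro mult_pos_pos add_pos_nonneg) auto
  have 2: "0 \<le> 6 * b\<^sup>2 * p\<^sup>2 * (2 + (2 - b\<^sup>2) * (p\<^sup>2 + q\<^sup>2))"
    using b by (intro mult_nonneg_nonneg add_nonneg_nonneg) auto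
  have 3: "0 \<le> 2 * b\<^sup>2 * p\<^sup>2 * (2 + 4 * b\<^sup>2 + (2 + b\<^sup>2) * (p\<^sup>2 + q\<^sup>2))"
    by (intro mult_nonneg_nonneg add_nonneg_nonneg) auto
  show "coeff_lambda b p q > 0" "euler_coeff b p q > 0"
    using 1 2 3 unfolding coeff_lambda_def euler_coeff_def by linarith+
qed

lemma coeffs_polynomial:
  "real_polynomial_function (\<lambda>p. coeff_lambda b p q)" "real_polynomial_function (\<lambda>q. coeff_lambda b p q)"
  "real_polynomial_function (\<lambda>p. euler_coeff b p q)" "real_polynomial_function (\<lambda>q. euler_coeff b p q)"
  unfolding coeff_lambda_def euler_coeff_def
  by (intro real_polynomial_function.intros(2-4) real_polynomial_function_power real_polynomial_function_diff
      real_polynomial_function.intros(1)[OF bounded_linear_ident])+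

text \<open>At \<open>p = 1\<close>, \<open>q = 2\<close>, \<open>p0 = q0 = 0\<close> the two sides of the identity differ, after division by the
  value at the origin, by \<open>- b\<^sup>4\<close> times a polynomial in \<open>b\<^sup>2\<close> that is positive for
  \<open>b\<^sup>2 < 1 / 4\<close>.\<close>
lemma coeffs_not_separable:
  assumes "b \<noteq> 0" and "\<bar>b\<bar> < 1 / 2"
  shows "\<not> separable_quotient (coeff_lambda b) UNIV UNIV"
    and "\<not> separable_quotient (euler_coeff b) UNIV UNIV"
proof -
  define c where "c = b\<^sup>2"
  have c: "0 < c" "c < 1 / 4"
    using assms power_strict_mono[of "\<bar>b\<bar>" "1 / 2" 2] by (simp_all add: c_def power_divide)
  show "\<not> separable_quotient (coeff_lambda b) UNIV UNIV"
  proof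
    assume "separable_quotient (coeff_lambda b) UNIV UNIV"
    then have "coeff_lambda b 1 2 * coeff_lambda b 0 0 * (coeff_lambda b 0 1 * coeff_lambda b 2 0)
      = coeff_lambda b 2 1 * coeff_lambda b 0 0 * (coeff_lambda b 1 0 * coeff_lambda b 0 2)"
      unfolding separable_quotient_def by blast
    then have "coeff_lambda b 1 2 * (coeff_lambda b 0 1 * coeff_lambda b 2 0)
      = coeff_lambda b 2 1 * (coeff_lambda b 1 0 * coeff_lambda b 0 2)"
      using coeffs_pos(1)[of b 0 0] assms by simp
    then have "c * c * (5322240 + 1907712 * c - 678240 * c ^ 2 - 101952 * c ^ 3 + 17280 * c ^ 4) = 0"
      unfolding coeff_lambda_def c_def[symmetric]
      by (simp add: algebra_simps power2_eq_square power3_eq_cube power4_eq_xxxx)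
    moreover have "c ^ 2 < 1" "c ^ 3 < 1" "0 < c ^ 4"
      using c by (simp_all add: power_less_one_iff)
    then have "0 < 5322240 + 1907712 * c - 678240 * c ^ 2 - 101952 * c ^ 3 + 17280 * c ^ 4"
      using c by linarith
    ultimately show False
      using c by simp
  qed
  show "\<not> separable_quotient (euler_coeff b) UNIV UNIV"
  proof
    assume "separable_quotient (euler_coeff b) UNIV UNIV"
    then have "euler_coeff b 1 2 * euler_coeff b 0 0 * (euler_coeff b 0 1 * euler_coeff b 2 0)
      = euler_coeff b 2 1 * euler_coeff b 0 0 * (euler_coeff b 1 0 * euler_coeff b 0 2)"
      unfolding separable_quotient_def by blast
    then have "euler_coeff b 1 2 * (euler_coeff b 0 1 * euler_coeff b 2 0)
      = euler_coeff b 2 1 * (euler_coeff b 1 0 * euler_coeff b 0 2)"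
      using coeffs_pos(2)[of b 0 0] assms by simp
    then have "c * c * (1451520 + 2663424 * c + 1791648 * c ^ 2 + 510336 * c ^ 3 + 50112 * c ^ 4) = 0"
      unfolding euler_coeff_def c_def[symmetric]
      by (simp add: algebra_simps power2_eq_square power3_eq_cube power4_eq_xxxx)
    moreover have "0 < 1451520 + 2663424 * c + 1791648 * c ^ 2 + 510336 * c ^ 3 + 50112 * c ^ 4"
      using c by (intro add_pos_nonneg) auto
    ultimately show False
      using c by simp
  qed
qed

lemma coeff_mu_eq: "coeff_mu b p q = coeff_lambda b q p"
  by (simp add: coeff_mu_def coeff_lambda_def add.commute)

theorem theorem5p1:
  fixes b :: real and U :: "(real ^ 2) set" and f g :: "real \<Rightarrow> real"
  assumes "0 \<le> b" and "b < 1 / 2"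
    and "open U"
    and "smooth_on f ((\<lambda>x. x $ 1) ` U)"
    and "smooth_on g ((\<lambda>x. x $ 2) ` U)"
  shows "minimal_on b U (translation_surface f g) \<longleftrightarrow>
    (\<forall>x\<in>U.
       coeff_lambda b (deriv f (x $ 1)) (deriv g (x $ 2)) * deriv (deriv f) (x $ 1)
       + coeff_mu b (deriv f (x $ 1)) (deriv g (x $ 2)) * deriv (deriv g) (x $ 2) = 0)"
proof -
  have b: "\<bar>b\<bar> < 1" "\<bar>b\<bar> < 1 / 2" using assms(1,2) by simp_all
  note minimal = minimal_translation_surface_iff[OF b(1) assms(3-5)]
  show ?thesis
  proof (cases "b = 0")
    case True
    then have "euler_coeff b = coeff_lambda b"
      by (simp add: fun_eq_iff euler_coeff_def coeff_lambda_def)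
    then show ?thesis
      unfolding minimal coeff_mu_eq by (simp only:)
  next
    case False
    note affine_iff = separated_equation_iff[OF assms(3-5)]
    show ?thesis
      unfolding minimal coeff_mu_eq
        affine_iff[of "euler_coeff b", OF coeffs_polynomial(3,4) coeffs_pos(2)[OF b(1)] coeffs_not_separable(2)[OF False b(2)]]
        affine_iff[of "coeff_lambda b", OF coeffs_polynomial(1,2) coeffs_pos(1)[OF b(1)] coeffs_not_separable(1)[OF False b(2)]]
      by (rule refl)
  qed
qed

end
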